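(* Let $p \geq 5$ be a prime. Let $V$ be a finite elementary abelian $p$-group which is an F-module for the finite $p$-group $G$. Then there exists a quadratic offender $E \leq G$ on $V$ which is normal in its normal closure $\langle E^G \rangle$ in $G$.
   Context: Let $G$ be a finite $p$-group and $V$ a finite elementary abelian $p$-group on which $G$ acts faithfully. An offender on $V$ in $G$ is a nontrivial elementary abelian subgroup $E$ of $G$ such that $|E|\,|C_V(E)| \geq |V|$. $V$ is an F-module for $G$ if $G$ acts faithfully on $V$ and there exists an offender on $V$ in $G$. A subgroup $E$ acts quadratically on $V$ if $[V,E,E]=1$ and $E$ does not centralize $V$ (commutators computed in the semidirect product $V\rtimes G$, and $[V,E,E]=[[V,E],E]$). A quadratic offender is an offender that acts quadratically on $V$. $\langle E^G\rangle$ denotes the subgroup generated by all $G$-conjugates of $E$. *)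

theory Defs
  imports
    "HOL-Computational_Algebra.Primes"
    "HOL-Algebra.Generated_Groups"
    "HOL-Algebra.Group_Action"
begin

definition finite_p_group :: "nat \<Rightarrow> ('a, 'b) monoid_scheme \<Rightarrow> bool" where
  "finite_p_group p G \<longleftrightarrow> group G \<and> finite (carrier G) \<and> (\<exists>n. order G = p ^ n)"

text \<open>The trivial group counts as elementary abelian.\<close>

definition elementary_abelian :: "nat \<Rightarrow> ('a, 'b) monoid_scheme \<Rightarrow> bool" where
  "elementary_abelian p G \<longleftrightarrow>
     comm_group G \<and> finite (carrier G) \<and> (\<forall>x\<in>carrier G. x [^]\<^bsub>G\<^esub> p = \<one>\<^bsub>G\<^esub>)"

text \<open>Left actions by automorphisms: \<open>\<phi> g v\<close> is the image of \<open>v\<close> under \<open>g\<close>. A right action,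
  written \<open>v\<^sup>g\<close>, corresponds to \<open>\<phi> (inv g) v\<close>.\<close>

definition acts_faithfully ::
  "('g, 'm) monoid_scheme \<Rightarrow> ('v, 'n) monoid_scheme \<Rightarrow> ('g \<Rightarrow> 'v \<Rightarrow> 'v) \<Rightarrow> bool" where
  "acts_faithfully G V \<phi> \<longleftrightarrow>
     faithful_action G (carrier V) \<phi> \<and> (\<forall>g\<in>carrier G. \<phi> g \<in> auto V)"

definition centralizer_in :: "('v, 'n) monoid_scheme \<Rightarrow> ('g \<Rightarrow> 'v \<Rightarrow> 'v) \<Rightarrow> 'g set \<Rightarrow> 'v set" where
  "centralizer_in V \<phi> E = {v \<in> carrier V. \<forall>g\<in>E. \<phi> g v = v}"

definition offender ::
  "nat \<Rightarrow> ('g, 'm) monoid_scheme \<Rightarrow> ('v, 'n) monoid_scheme \<Rightarrow> ('g \<Rightarrow> 'v \<Rightarrow> 'v) \<Rightarrow> 'g set \<Rightarrow> bool"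
  where
  "offender p G V \<phi> E \<longleftrightarrow>
     subgroup E G \<and> elementary_abelian p (G\<lparr>carrier := E\<rparr>) \<and> E \<noteq> {\<one>\<^bsub>G\<^esub>} \<and>
     card E * card (centralizer_in V \<phi> E) \<ge> card (carrier V)"

definition F_module ::
  "nat \<Rightarrow> ('g, 'm) monoid_scheme \<Rightarrow> ('v, 'n) monoid_scheme \<Rightarrow> ('g \<Rightarrow> 'v \<Rightarrow> 'v) \<Rightarrow> bool" where
  "F_module p G V \<phi> \<longleftrightarrow> acts_faithfully G V \<phi> \<and> (\<exists>E. offender p G V \<phi> E)"

definition semidirect ::
  "('v, 'n) monoid_scheme \<Rightarrow> ('g, 'm) monoid_scheme \<Rightarrow> ('g \<Rightarrow> 'v \<Rightarrow> 'v) \<Rightarrow> ('v \<times> 'g) monoid" where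
  "semidirect V G \<phi> =
     \<lparr>carrier = carrier V \<times> carrier G,
      mult = (\<lambda>(v, g) (w, h). (v \<otimes>\<^bsub>V\<^esub> \<phi> g w, g \<otimes>\<^bsub>G\<^esub> h)),
      one = (\<one>\<^bsub>V\<^esub>, \<one>\<^bsub>G\<^esub>)\<rparr>"

lemma semidirect_group:
  assumes "group V" and "acts_faithfully G V \<phi>"
  shows "group (semidirect V G \<phi>)"
proof -
  interpret V: group V by fact
  interpret A: faithful_action G "carrier V" \<phi>
    using assms(2) by (simp add: acts_faithfully_def)
  interpret G: group G
    using A.group_hom by (simp add: group_hom_def)
  have cl: "\<phi> g v \<in> carrier V" if "g \<in> carrier G" "v \<in> carrier V" for g v
    using A.element_image that by blast
  have hom: "\<phi> g (v \<otimes>\<^bsub>V\<^esub> w) = \<phi> g v \<otimes>\<^bsub>V\<^esub> \<phi> g w"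
    if "g \<in> carrier G" "v \<in> carrier V" "w \<in> carrier V" for g v w
    using assms(2) that by (auto simp: acts_faithfully_def auto_def hom_def)
  have comp: "\<phi> (g \<otimes>\<^bsub>G\<^esub> h) v = \<phi> g (\<phi> h v)"
    if "g \<in> carrier G" "h \<in> carrier G" "v \<in> carrier V" for g h v
    using A.composition_rule that by blast
  have one: "\<phi> \<one>\<^bsub>G\<^esub> v = v" if "v \<in> carrier V" for v
    using A.id_eq_one that by (metis restrict_apply')
  show ?thesis
  proof (rule groupI)
    fix x assume "x \<in> carrier (semidirect V G \<phi>)"
    then obtain v g where x: "x = (v, g)" and v: "v \<in> carrier V" and g: "g \<in> carrier G"
      by (auto simp: semidirect_def)
    have "\<phi> (inv\<^bsub>G\<^esub> g) (inv\<^bsub>V\<^esub> v) \<otimes>\<^bsub>V\<^esub> \<phi> (inv\<^bsub>G\<^esub> g) v = \<one>\<^bsub>V\<^esub>"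
      using hom[of "inv\<^bsub>G\<^esub> g" "inv\<^bsub>V\<^esub> v" v] hom[of "inv\<^bsub>G\<^esub> g" "\<one>\<^bsub>V\<^esub>" "\<one>\<^bsub>V\<^esub>"] v g
      by (simp add: cl V.l_cancel_one')
    then show "\<exists>y\<in>carrier (semidirect V G \<phi>).
        y \<otimes>\<^bsub>semidirect V G \<phi>\<^esub> x = \<one>\<^bsub>semidirect V G \<phi>\<^esub>"
      using v g x cl
      by (intro bexI[of _ "(\<phi> (inv\<^bsub>G\<^esub> g) (inv\<^bsub>V\<^esub> v), inv\<^bsub>G\<^esub> g)"]) (auto simp: semidirect_def)
  qed (auto simp: semidirect_def cl hom comp one V.m_assoc G.m_assoc)
qed

definition commutator_subgroup :: "('a, 'b) monoid_scheme \<Rightarrow> 'a set \<Rightarrow> 'a set \<Rightarrow> 'a set" where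
  "commutator_subgroup S A B =
     generate S {a \<otimes>\<^bsub>S\<^esub> b \<otimes>\<^bsub>S\<^esub> inv\<^bsub>S\<^esub> a \<otimes>\<^bsub>S\<^esub> inv\<^bsub>S\<^esub> b | a b. a \<in> A \<and> b \<in> B}"

text \<open>Inside the semidirect product, \<open>V\<close> and \<open>E\<close> are identified with \<open>V \<times> {1}\<close> and
  \<open>{1} \<times> E\<close>.\<close>

definition acts_quadratically ::
  "('g, 'm) monoid_scheme \<Rightarrow> ('v, 'n) monoid_scheme \<Rightarrow> ('g \<Rightarrow> 'v \<Rightarrow> 'v) \<Rightarrow> 'g set \<Rightarrow> bool" where
  "acts_quadratically G V \<phi> E \<longleftrightarrow>
     (let S = semidirect V G \<phi>; V' = carrier V \<times> {\<one>\<^bsub>G\<^esub>}; E' = {\<one>\<^bsub>V\<^esub>} \<times> E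
      in commutator_subgroup S (commutator_subgroup S V' E') E' = {\<one>\<^bsub>S\<^esub>}) \<and>
     centralizer_in V \<phi> E \<noteq> carrier V"

definition quadratic_offender ::
  "nat \<Rightarrow> ('g, 'm) monoid_scheme \<Rightarrow> ('v, 'n) monoid_scheme \<Rightarrow> ('g \<Rightarrow> 'v \<Rightarrow> 'v) \<Rightarrow> 'g set \<Rightarrow> bool"
  where
  "quadratic_offender p G V \<phi> E \<longleftrightarrow> offender p G V \<phi> E \<and> acts_quadratically G V \<phi> E"

definition normal_closure :: "('a, 'b) monoid_scheme \<Rightarrow> 'a set \<Rightarrow> 'a set" where
  "normal_closure G E = generate G {inv\<^bsub>G\<^esub> g \<otimes>\<^bsub>G\<^esub> x \<otimes>\<^bsub>G\<^esub> g | g x. g \<in> carrier G \<and> x \<in> E}"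

end

theory Submission
  imports Defs "HOL-Computational_Algebra.Formal_Power_Series" "HOL-Library.Product_Plus"
begin

text \<open>
  Write the action of \<open>G\<close> inside a ring of endomorphisms. A quadratic offender is then a set
  \<open>E = 1 + S\<close>, where \<open>S\<close> is an additive group of endomorphisms such that all products of two elements of
  \<open>S\<close> vanish. Call an element \<open>x = 1 + a\<close> of \<open>G\<close> quadratic if \<open>a\<^sup>2 = 0\<close>. The proof yields more
  than is claimed: some quadratic offender is normalized by all quadratic elements of \<open>G\<close>, in
  particular by the elements of all its conjugates.

  The main tool is a limit. The conjugates of \<open>S\<close> by \<open>1 + t a\<close> form a family that is polynomial in
  \<open>t\<close>, and its limit for \<open>t \<rightarrow> \<infinity>\<close> makes sense formally, by taking leading coefficients over a
  ring of power series in \<open>1/t\<close>, even though only \<open>p\<close> values of \<open>t\<close> give group elements. The limit is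
  again additive with vanishing products. Its order is not smaller than that of \<open>S\<close>, and the same
  holds for the limit of the fixed points, so the offender inequality survives
  (\<open>card_le_card_lead\<close>). As a limit for \<open>t \<rightarrow> \<infinity>\<close> it is stable under translations of \<open>t\<close>, that
  is, under conjugation by \<open>x\<close> (\<open>limit_bi_conj\<close>).

  Among all quadratic offenders choose \<open>E\<close> such that the subgroup \<open>K\<close> generated by the quadratic
  elements normalizing \<open>E\<close> is as large as possible. Suppose that some quadratic element is not in \<open>K\<close>.
  Since \<open>G\<close> is a \<open>p\<close>-group, some quadratic element \<open>x\<close> outside \<open>K\<close> normalizes \<open>K\<close>
  (\<open>exists_normalizing_generator\<close>). Take the limit of \<open>E\<close> along \<open>x\<close>. It lies in \<open>G\<close>, because its
  elements are products of elements of three conjugates of \<open>E\<close> that are normal in \<open>K\<close>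
  (\<open>exp_three_factors\<close>, \<open>limit_in_group\<close>). It is normalized by \<open>K\<close>: the conditions that express
  this are polynomial of degree four in \<open>t\<close>, and they hold for the residues \<open>t\<close> modulo
  \<open>p\<close>, of which there are at least five (\<open>limit_bi_conj_interpolated\<close>). And it is normalized
  by \<open>x\<close>. This contradicts the choice of \<open>E\<close>.

  A quadratic offender exists in the first place by Timmesfeld's replacement argument
  (\<open>quad_replacement\<close>).\<close>

unbundle fps_syntax

section \<open>Additive subgroups and interpolation\<close>

definition add_subgroup :: "'a::ab_group_add set \<Rightarrow> bool" where
  "add_subgroup S \<longleftrightarrow> 0 \<in> S \<and> (\<forall>x\<in>S. \<forall>y\<in>S. x - y \<in> S)"

lemma add_subgroup_zero: "add_subgroup S \<Longrightarrow> 0 \<in> S"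
  by (simp add: add_subgroup_def)

lemma add_subgroup_diff: "add_subgroup S \<Longrightarrow> x \<in> S \<Longrightarrow> y \<in> S \<Longrightarrow> x - y \<in> S"
  by (simp add: add_subgroup_def)

lemma add_subgroup_minus: "add_subgroup S \<Longrightarrow> x \<in> S \<Longrightarrow> - x \<in> S"
  using add_subgroup_diff[of S 0 x] by (simp add: add_subgroup_zero)

lemma add_subgroup_add: "add_subgroup S \<Longrightarrow> x \<in> S \<Longrightarrow> y \<in> S \<Longrightarrow> x + y \<in> S"
  using add_subgroup_diff[of S x "- y"] by (simp add: add_subgroup_minus)

lemma add_subgroup_of_nat:
  fixes x :: "'a::ring_1"
  assumes "add_subgroup S" "x \<in> S"
  shows "of_nat k * x \<in> S"
  using assms by (induction k) (auto simp: add_subgroup_zero add_subgroup_add algebra_simps)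

lemma add_subgroup_numeral:
  fixes x :: "'a::ring_1"
  assumes "add_subgroup S" "x \<in> S"
  shows "numeral k * x \<in> S"
  using add_subgroup_of_nat[OF assms, of "numeral k"] by simp

lemmas add_subgroup_rules =
  add_subgroup_zero add_subgroup_diff add_subgroup_minus add_subgroup_add
  add_subgroup_of_nat add_subgroup_numeral

text \<open>By Bezout, multiplication by \<open>k\<close> is invertible modulo \<open>p\<close>.\<close>

lemma torsion_divide:
  fixes c :: "'a::ring_1"
  assumes "add_subgroup S" "coprime k p" "p > 1" "of_nat p * c = 0" "of_nat k * c \<in> S"
  shows "c \<in> S"
proof -
  obtain x y where xy: "k * x = p * y + 1"
    using coprime_bezout_strong[OF assms(2)] assms(3) by auto
  have "of_nat x * (of_nat k * c) = of_nat (x * k) * c"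
    by (simp only: of_nat_mult mult.assoc)
  also have "x * k = y * p + 1" using xy by (simp only: mult.commute)
  also have "of_nat (y * p + 1) * c = of_nat y * (of_nat p * c) + c"
    by (simp only: of_nat_mult of_nat_add of_nat_1 distrib_right mult.assoc mult_1_left)
  also have "\<dots> = c" using assms(4) by simp
  finally show ?thesis
    using add_subgroup_of_nat[OF assms(1,5), of x] by simp
qed

lemma torsion_divide_dvd:
  fixes c :: "'a::ring_1"
  assumes "add_subgroup S" "prime p" "\<not> p dvd k" "of_nat p * c = 0" "of_nat k * c \<in> S"
  shows "c \<in> S"
proof (rule torsion_divide[OF assms(1) _ _ assms(4,5)])
  show "coprime k p" using prime_imp_coprime[OF assms(2,3)] by (simp add: coprime_commute)
qed (rule prime_gt_1_nat[OF assms(2)])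

lemma prime_ge_5_not_dvd:
  assumes "prime (p::nat)" "p \<ge> 5" shows "\<not> p dvd 2" "\<not> p dvd 6" "\<not> p dvd 24"
proof -
  show "\<not> p dvd 2" using assms(2) by (auto dest: dvd_imp_le)
  have 3: "\<not> p dvd 3" using assms(2) by (auto dest: dvd_imp_le)
  show 6: "\<not> p dvd 6"
    using prime_dvd_mult_iff[OF assms(1), of 2 3] 3 \<open>\<not> p dvd 2\<close> by auto
  show "\<not> p dvd 24"
    using prime_dvd_mult_iff[OF assms(1), of 2 12] prime_dvd_mult_iff[OF assms(1), of 2 6]
      6 \<open>\<not> p dvd 2\<close> by auto
qed

text \<open>A polynomial of degree at most four is determined by its values at \<open>0, \<dots>, 4\<close>, with denominators
  dividing 24. These are five distinct residues, and 24 is a unit, exactly when \<open>p \<ge> 5\<close>.\<close>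

lemma coefficients_in_subgroup:
  fixes c0 c1 c2 c3 c4 :: "'a::ring_1"
  assumes S: "add_subgroup S" and p: "prime p" "p \<ge> 5"
    and tor: "of_nat p * c1 = 0" "of_nat p * c2 = 0" "of_nat p * c3 = 0" "of_nat p * c4 = 0"
    and val: "\<And>t::nat. t \<le> 4 \<Longrightarrow>
      c0 + of_nat t * c1 + of_nat (t^2) * c2 + of_nat (t^3) * c3 + of_nat (t^4) * c4 \<in> S"
  shows "c0 \<in> S" "c1 \<in> S" "c2 \<in> S" "c3 \<in> S" "c4 \<in> S"
proof -
  note S' = add_subgroup_rules[OF S]
  note div = torsion_divide_dvd[OF S p(1)]
  note nd = prime_ge_5_not_dvd[OF p]
  define L :: "int \<Rightarrow> int \<Rightarrow> int \<Rightarrow> int \<Rightarrow> int \<Rightarrow> 'a"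
    where "L x0 x1 x2 x3 x4 = of_int x0 * c0 + of_int x1 * c1 + of_int x2 * c2 + of_int x3 * c3 + of_int x4 * c4"
    for x0 x1 x2 x3 x4
  have L_diff: "L x0 x1 x2 x3 x4 - L y0 y1 y2 y3 y4 = L (x0 - y0) (x1 - y1) (x2 - y2) (x3 - y3) (x4 - y4)"
    for x0 x1 x2 x3 x4 y0 y1 y2 y3 y4 by (simp add: L_def algebra_simps)
  have Ld: "L (x0 - y0) (x1 - y1) (x2 - y2) (x3 - y3) (x4 - y4) \<in> S"
    if "L x0 x1 x2 x3 x4 \<in> S" "L y0 y1 y2 y3 y4 \<in> S" for x0 x1 x2 x3 x4 y0 y1 y2 y3 y4
    using S'(2)[OF that] by (simp add: L_diff)
  have v: "L 1 (int t) (int t ^ 2) (int t ^ 3) (int t ^ 4) \<in> S" if "t \<le> 4" for t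
    using val[OF that] by (simp add: L_def)
  have v0: "L 1 0 0 0 0 \<in> S" and v1: "L 1 1 1 1 1 \<in> S" and v2: "L 1 2 4 8 16 \<in> S"
    and v3: "L 1 3 9 27 81 \<in> S" and v4: "L 1 4 16 64 256 \<in> S"
    using v[of 0] v[of 1] v[of 2] v[of 3] v[of 4] by simp_all
  show c0: "c0 \<in> S" using v0 by (simp add: L_def)
  (* iterated differences of the values at 0, ..., 4 *)
  note d1 = Ld[OF v1 v0] Ld[OF v2 v1] Ld[OF v3 v2] Ld[OF v4 v3]
  note d2 = Ld[OF d1(2) d1(1)] Ld[OF d1(3) d1(2)] Ld[OF d1(4) d1(3)]
  note d3 = Ld[OF d2(2) d2(1)] Ld[OF d2(3) d2(2)]
  note d4 = Ld[OF d3(2) d3(1)]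
  have "of_nat 24 * c4 \<in> S" using d4 by (simp add: L_def)
  then show c4: "c4 \<in> S" using div[OF nd(3) tor(4)] by simp
  have e3: "of_nat 6 * c3 + 36 * c4 \<in> S" using d3(1) by (simp add: L_def)
  have cancel: "x \<in> S" if "x + y \<in> S" "y \<in> S" for x y
    using S'(2)[OF that] by simp
  have "36 * c4 \<in> S" by (intro S' c4)
  then have "of_nat 6 * c3 \<in> S" by (rule cancel[OF e3])
  then show c3: "c3 \<in> S" using div[OF nd(2) tor(3)] by simp
  have e2: "of_nat 2 * c2 + (6 * c3 + 14 * c4) \<in> S" using d2(1) by (simp add: L_def add.assoc)
  have "6 * c3 + 14 * c4 \<in> S" by (intro S' c3 c4)
  then have "of_nat 2 * c2 \<in> S" by (rule cancel[OF e2])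
  then show c2: "c2 \<in> S" using div[OF nd(1) tor(2)] by simp
  have e1: "c1 + (c2 + c3 + c4) \<in> S" using d1(1) by (simp add: L_def add.assoc)
  have "c2 + c3 + c4 \<in> S" by (intro S' c2 c3 c4)
  then show "c1 \<in> S" by (rule cancel[OF e1])
qed

section \<open>Lowest coefficients of power series\<close>

text \<open>The lowest nonzero coefficients of the series in \<open>N\<close>, together with 0 (every coefficient of a
  series up to and including the first nonzero one qualifies). If \<open>N\<close> is a family of groups
  depending on a parameter, written in the variable \<open>1/t\<close> and cleared of denominators, this is the
  limit of the family for \<open>t \<rightarrow> \<infinity>\<close>.\<close>

definition lead :: "'a::zero fps set \<Rightarrow> 'a set" where
  "lead N = {F $ n | F n. F \<in> N \<and> (\<forall>i<n. F $ i = 0)}"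

definition series :: "'a set \<Rightarrow> 'a fps set" where
  "series S = {f. \<forall>n. f $ n \<in> S}"

lemma leadI: "F \<in> N \<Longrightarrow> (\<And>i. i < n \<Longrightarrow> F $ i = 0) \<Longrightarrow> F $ n = x \<Longrightarrow> x \<in> lead N"
  by (auto simp: lead_def)

lemma leadE:
  assumes "x \<in> lead N"
  obtains F n where "F \<in> N" "\<And>i. i < n \<Longrightarrow> F $ i = 0" "x = F $ n"
  using assms by (auto simp: lead_def)

lemma add_subgroup_series:
  fixes S :: "'a::ring_1 set"
  shows "add_subgroup S \<Longrightarrow> add_subgroup (series S)"
  by (auto simp: add_subgroup_def series_def)

lemma series_X_mult:
  fixes S :: "'a::ring_1 set"
  shows "add_subgroup S \<Longrightarrow> f \<in> series S \<Longrightarrow> fps_X ^ k * f \<in> series S"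
  by (auto simp: series_def add_subgroup_zero fps_X_power_mult_nth)

lemma add_subgroup_lead:
  fixes N :: "'a::ring_1 fps set"
  assumes N: "add_subgroup N" and X: "\<And>F k. F \<in> N \<Longrightarrow> fps_X ^ k * F \<in> N"
  shows "add_subgroup (lead N)"
  unfolding add_subgroup_def
proof (intro conjI ballI)
  show "0 \<in> lead N"
    by (rule leadI[of 0 N 0]) (use N in \<open>auto simp: add_subgroup_zero\<close>)
next
  fix x y assume "x \<in> lead N" "y \<in> lead N"
  then obtain F n F' m where F: "F \<in> N" "\<And>i. i < n \<Longrightarrow> F $ i = 0" "x = F $ n"
    and F': "F' \<in> N" "\<And>i. i < m \<Longrightarrow> F' $ i = 0" "y = F' $ m"
    by (metis leadE)
  show "x - y \<in> lead N"
  proof (rule leadI[where n = "n + m"])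
    show "fps_X ^ m * F - fps_X ^ n * F' \<in> N"
      by (intro add_subgroup_diff[OF N] X F(1) F'(1))
  qed (use F F' in \<open>auto simp: fps_X_power_mult_nth\<close>)
qed

lemma lead_mult_zero:
  fixes N N' :: "'a::ring_1 fps set"
  assumes "\<And>F F'. F \<in> N \<Longrightarrow> F' \<in> N' \<Longrightarrow> F * F' = 0" "x \<in> lead N" "y \<in> lead N'"
  shows "x * y = 0"
proof -
  obtain F n F' m where F: "F \<in> N" "\<And>i. i < n \<Longrightarrow> F $ i = 0" "x = F $ n"
    and F': "F' \<in> N'" "\<And>i. i < m \<Longrightarrow> F' $ i = 0" "y = F' $ m"
    using assms(2,3) by (metis leadE)
  have "0 = (F * F') $ (n + m)" using assms(1) F(1) F'(1) by simp
  also have "\<dots> = (\<Sum>i=0..n+m. F $ i * F' $ (n + m - i))" by (rule fps_mult_nth)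
  also have "\<dots> = (\<Sum>i\<in>{n}. F $ i * F' $ (n + m - i))"
  proof (rule sum.mono_neutral_right)
    show "\<forall>i\<in>{0..n + m} - {n}. F $ i * F' $ (n + m - i) = 0"
    proof
      fix i assume "i \<in> {0..n + m} - {n}"
      then have "i < n \<or> n + m - i < m" by auto
      then show "F $ i * F' $ (n + m - i) = 0" using F(2) F'(2) by auto
    qed
  qed auto
  finally show ?thesis using F(3) F'(3) by simp
qed

text \<open>Two series with the same truncation at order \<open>m\<close> differ by a series whose coefficient of order
  \<open>m\<close> lies in \<open>lead N\<close>. Hence each further coefficient multiplies the number of
  truncations by at most \<open>card (lead N)\<close>.\<close>

lemma card_truncations_le:
  fixes N :: "'a::ring_1 fps set"
  assumes N: "add_subgroup N" and fin: "finite (lead N)"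
  shows "finite (fps_cutoff m ` N) \<and> card (fps_cutoff m ` N) \<le> card (lead N) ^ m"
proof (induction m)
  case 0
  have "fps_cutoff 0 ` N = {0}" using add_subgroup_zero[OF N] by (auto simp: fps_cutoff_zero)
  then show ?case by simp
next
  case (Suc m)
  let ?B = "fps_cutoff m ` N"
  define r where "r b = (SOME F. F \<in> N \<and> fps_cutoff m F = b)" for b
  have r: "r b \<in> N \<and> fps_cutoff m (r b) = b" if "b \<in> ?B" for b
    unfolding r_def by (rule someI_ex) (use that in auto)
  define \<theta> where "\<theta> F = (fps_cutoff m F, F $ m - r (fps_cutoff m F) $ m)" for F
  have cut: "fps_cutoff k F $ i = (if i < k then F $ i else 0)" for k i and F :: "'a fps"
    by (simp add: fps_cutoff_def)
  have \<theta>_cut: "\<theta> (fps_cutoff (Suc m) F) = \<theta> F" for F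
  proof -
    have "fps_cutoff m (fps_cutoff (Suc m) F) = fps_cutoff m F"
      by (rule fps_ext) (simp add: cut)
    then show ?thesis by (simp add: \<theta>_def cut)
  qed
  have key: "fps_cutoff (Suc m) F = fps_cutoff (Suc m) F'" if "\<theta> F = \<theta> F'" for F F'
  proof -
    from that
    have "fps_cutoff m F = fps_cutoff m F'" "F $ m = F' $ m" by (auto simp: \<theta>_def)
    then have "F $ i = F' $ i" if "i < Suc m" for i
      using that by (metis cut less_Suc_eq)
    then show "fps_cutoff (Suc m) F = fps_cutoff (Suc m) F'"
      by (intro fps_ext) (simp add: cut)
  qed
  have inj: "inj_on \<theta> (fps_cutoff (Suc m) ` N)"
    by (rule inj_onI) (auto simp: \<theta>_cut intro: key)
  have sub: "\<theta> ` (fps_cutoff (Suc m) ` N) \<subseteq> ?B \<times> lead N"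
  proof
    fix y assume "y \<in> \<theta> ` (fps_cutoff (Suc m) ` N)"
    then obtain F where F: "F \<in> N" and y: "y = \<theta> F" by (auto simp: \<theta>_cut)
    have R: "r (fps_cutoff m F) \<in> N" "fps_cutoff m (r (fps_cutoff m F)) = fps_cutoff m F"
      using r[OF imageI[OF F]] by blast+
    have eq: "F $ i = r (fps_cutoff m F) $ i" if "i < m" for i
      using cut[of m F i] cut[of m "r (fps_cutoff m F)" i] R(2) that by simp
    have "F $ m - r (fps_cutoff m F) $ m \<in> lead N"
      by (rule leadI[of "F - r (fps_cutoff m F)" _ m])
         (use add_subgroup_diff[OF N F R(1)] eq in simp_all)
    then show "y \<in> ?B \<times> lead N" using F by (auto simp: \<theta>_def y)
  qed
  have fin2: "finite (?B \<times> lead N)" using Suc fin by auto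
  note inj_on_finite[OF inj sub fin2] card_inj_on_le[OF inj sub fin2]
  moreover have "card (?B \<times> lead N) \<le> card (lead N) ^ Suc m"
    using Suc by (simp add: card_cartesian_product mult.commute mult_le_mono2)
  ultimately show ?case by simp
qed

lemma le_of_power_le_power_add:
  fixes a b d :: nat
  assumes "a > 0" "\<And>m. a ^ m \<le> b ^ (m + d)"
  shows "a \<le> b"
proof (rule ccontr)
  assume "\<not> a \<le> b"
  then have ab: "b + 1 \<le> a" by simp
  have b: "b > 0" using assms(2)[of 1] assms(1) by (cases b) auto
  have bern: "b ^ m * (b + m) \<le> b * (b + 1) ^ m" for m
  proof (induction m)
    case (Suc m)
    have "b ^ Suc m * (b + Suc m) \<le> (b ^ m * (b + m)) * (b + 1)"
      by (simp add: algebra_simps)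
    also have "\<dots> \<le> (b * (b + 1) ^ m) * (b + 1)" using Suc by (rule mult_le_mono1)
    finally show ?case by (simp add: algebra_simps)
  qed simp
  let ?m = "b * b ^ d"
  have "b ^ ?m * (b + ?m) \<le> b * (b + 1) ^ ?m" by (rule bern)
  also have "\<dots> \<le> b * a ^ ?m" using ab by (intro mult_le_mono2 power_mono) auto
  also have "\<dots> \<le> b * b ^ (?m + d)" using assms(2) by (intro mult_le_mono2)
  also have "\<dots> = b ^ ?m * ?m" by (simp add: power_add)
  finally show False using b by simp
qed

text \<open>Passing to the limit does not make a group smaller. The map \<open>f \<mapsto> A * f * B\<close> is invertible up to
  the factor \<open>X ^ d\<close>, so it loses at most \<open>d\<close> orders of precision, and the number of truncations
  of \<open>N\<close> at order \<open>m + d\<close> is at least \<open>card S ^ m\<close>. Comparing with the upper bound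
  \<open>card (lead N) ^ (m + d)\<close> for all \<open>m\<close> gives the claim.\<close>

lemma card_le_card_lead:
  fixes S :: "'a::ring_1 set" and A B A' B' :: "'a fps"
  assumes S: "add_subgroup S" "finite S"
    and N: "N = {A * f * B | f. f \<in> series S}" and fin: "finite (lead N)"
    and inv: "\<And>f. A' * (A * f * B) * B' = fps_X ^ d * f"
  shows "card S \<le> card (lead N)"
proof (rule le_of_power_le_power_add)
  show "card S > 0" using S using add_subgroup_zero[OF S(1)] by (auto simp: card_gt_0_iff)
  have subN: "add_subgroup N"
    unfolding add_subgroup_def
  proof (intro conjI ballI)
    have "0 = A * 0 * B" by simp
    then show "0 \<in> N"
      unfolding N mem_Collect_eq using add_subgroup_zero[OF add_subgroup_series[OF S(1)]] by (intro exI conjI)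
  next
    fix x y assume "x \<in> N" "y \<in> N"
    then obtain f g where fg: "f \<in> series S" "g \<in> series S" and "x = A * f * B" "y = A * g * B"
      unfolding N by blast
    then have "x - y = A * (f - g) * B" by (simp add: algebra_simps)
    moreover have "f - g \<in> series S" by (rule add_subgroup_diff[OF add_subgroup_series[OF S(1)] fg])
    ultimately show "x - y \<in> N" unfolding N by blast
  qed
  fix m
  let ?L = "{xs. set xs \<subseteq> S \<and> length xs = m}"
  define s where "s xs = Abs_fps (\<lambda>i. if i < m then xs ! i else 0)" for xs :: "'a list"
  define \<theta> where "\<theta> xs = fps_cutoff (m + d) (A * s xs * B)" for xs
  have s: "s xs \<in> series S" if "xs \<in> ?L" for xs
    using that S(1) by (auto simp: s_def series_def add_subgroup_zero subset_iff)
  have "inj_on \<theta> ?L"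
  proof (rule inj_onI)
    fix xs ys assume xs: "xs \<in> ?L" and ys: "ys \<in> ?L" and eq: "\<theta> xs = \<theta> ys"
    have cut: "(A * s xs * B) $ i = (A * s ys * B) $ i" if "i < m + d" for i
    proof -
      have "fps_cutoff (m + d) (A * s xs * B) $ i = fps_cutoff (m + d) (A * s ys * B) $ i"
        using eq by (simp add: \<theta>_def)
      then show ?thesis using that by (simp add: fps_cutoff_def)
    qed
    have "xs ! i = ys ! i" if "i < m" for i
    proof -
      have left: "(A' * (A * s xs * B)) $ j = (A' * (A * s ys * B)) $ j" if "j < m + d" for j
        unfolding fps_mult_nth[of A'] using that by (intro sum.cong refl) (simp add: cut)
      have "(A' * (A * s xs * B) * B') $ (i + d) = (A' * (A * s ys * B) * B') $ (i + d)"
        unfolding fps_mult_nth[of _ B'] using that by (intro sum.cong refl) (simp add: left)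
      then have "(fps_X ^ d * s xs) $ (i + d) = (fps_X ^ d * s ys) $ (i + d)"
        by (simp only: inv)
      then show ?thesis using that by (simp add: fps_X_power_mult_nth s_def)
    qed
    then show "xs = ys" using xs ys by (auto intro: nth_equalityI)
  qed
  moreover have "\<theta> ` ?L \<subseteq> fps_cutoff (m + d) ` N"
    using s by (auto simp: \<theta>_def N)
  moreover have "card ?L = card S ^ m" by (rule card_lists_length_eq[OF S(2)])
  ultimately have "card S ^ m \<le> card (fps_cutoff (m + d) ` N)"
    using card_truncations_le[OF subN fin, of "m + d"] card_inj_on_le by metis
  then show "card S ^ m \<le> card (lead N) ^ (m + d)"
    using card_truncations_le[OF subN fin, of "m + d"] by linarith
qed

section \<open>Limits under conjugation\<close>

text \<open>Let \<open>a * a = 0\<close>. With \<open>X = 1/t\<close>, the conjugate of \<open>s\<close> by \<open>1 + t a\<close> is a multiple of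
  \<open>(X + a) s (X - a)\<close>; here \<open>-a\<close> is used in place of \<open>a\<close>, so the family is
  \<open>(X - a) s (X + a)\<close>. The limit of \<open>S\<close> under conjugation is \<open>limit_bi a S\<close>, and
  \<open>limit_left a C\<close> is the corresponding limit of a set \<open>C\<close> of vectors, on which the ring
  acts from the left.\<close>

definition limit_bi :: "'a::ring_1 \<Rightarrow> 'a set \<Rightarrow> 'a set" where
  "limit_bi a S = lead {(fps_X - fps_const a) * f * (fps_X + fps_const a) | f. f \<in> series S}"

definition limit_left :: "'a::ring_1 \<Rightarrow> 'a set \<Rightarrow> 'a set" where
  "limit_left a S = lead {(fps_X - fps_const a) * f | f. f \<in> series S}"

lemma square_zero_X:
  fixes a :: "'a::ring_1"
  assumes "a * a = 0"
  shows "(fps_X - fps_const a) * (fps_X + fps_const a) = fps_X ^ 2"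
    and "(fps_X + fps_const a) * (fps_X - fps_const a) = fps_X ^ 2"
  using assms
  by (simp_all add: ring_distribs fps_mult_fps_X_commute[of "fps_const a"] power2_eq_square)

lemma fps_X_power_commute: "f * fps_X ^ k = fps_X ^ k * (f :: 'a::ring_1 fps)"
  by (rule fps_mult_fps_X_power_commute[symmetric])

lemma twist_expand:
  fixes a :: "'a::ring_1" and f :: "'a fps"
  shows "(fps_X - fps_const a) * f * (fps_X + fps_const a) =
    fps_X ^ 2 * f + fps_X * (f * fps_const a - fps_const a * f) - fps_const a * f * fps_const a"
proof -
  have X: "f * fps_X = fps_X * f" "fps_const a * (f * fps_X) = fps_X * (fps_const a * f)"
      "fps_const a * (fps_X * f) = fps_X * (fps_const a * f)"
    by (metis fps_mult_fps_X_commute mult.assoc)+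
  show ?thesis
    by (simp add: ring_distribs power2_eq_square mult.assoc X)
qed

lemma twist_nth:
  fixes a :: "'a::ring_1" and f :: "'a fps"
  shows "((fps_X - fps_const a) * f * (fps_X + fps_const a)) $ n =
    (if n < 2 then 0 else f $ (n - 2)) + (if n < 1 then 0 else f $ (n - 1) * a - a * f $ (n - 1))
    - a * f $ n * a"
  by (auto simp: twist_expand fps_X_power_mult_nth)

lemma twist_left_nth:
  fixes a :: "'a::ring_1" and f :: "'a fps"
  shows "((fps_X - fps_const a) * f) $ n = (if n = 0 then 0 else f $ (n - 1)) - a * f $ n"
  by (simp add: left_diff_distrib)

lemma add_subgroup_linear_image:
  fixes S :: "'a::ab_group_add set" and h :: "'a \<Rightarrow> 'b::ab_group_add"
  assumes "add_subgroup S" "\<And>x y. h (x - y) = h x - h y"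
  shows "add_subgroup {h f | f. f \<in> S}"
proof -
  have "h 0 = 0" using assms(2)[of 0 0] by simp
  show ?thesis
    unfolding add_subgroup_def mem_Collect_eq
  proof (intro conjI ballI)
    show "\<exists>f. 0 = h f \<and> f \<in> S" using \<open>h 0 = 0\<close> add_subgroup_zero[OF assms(1)] by metis
    fix x y assume "x \<in> {h f | f. f \<in> S}" "y \<in> {h f | f. f \<in> S}"
    then obtain f g where "f \<in> S" "g \<in> S" "x = h f" "y = h g" by blast
    then have "x - y = h (f - g) \<and> f - g \<in> S" by (simp add: assms(2) add_subgroup_diff[OF assms(1)])
    then show "\<exists>f. x - y = h f \<and> f \<in> S" by blast
  qed
qed

lemma limit_bi_subgroup:
  fixes S :: "'a::ring_1 set"
  assumes "add_subgroup S" shows "add_subgroup (limit_bi a S)"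
  unfolding limit_bi_def
proof (rule add_subgroup_lead)
  show "add_subgroup {(fps_X - fps_const a) * f * (fps_X + fps_const a) |f. f \<in> series S}"
    by (rule add_subgroup_linear_image[OF add_subgroup_series[OF assms]]) (simp add: ring_distribs)
  fix F k assume "F \<in> {(fps_X - fps_const a) * f * (fps_X + fps_const a) |f. f \<in> series S}"
  then obtain f where f: "f \<in> series S" "F = (fps_X - fps_const a) * f * (fps_X + fps_const a)" by auto
  have "fps_X ^ k * F = (fps_X - fps_const a) * (fps_X ^ k * f) * (fps_X + fps_const a)"
    unfolding f(2) mult.assoc[symmetric] fps_X_power_commute[symmetric, of _ "fps_X - fps_const a"] ..
  then show "fps_X ^ k * F \<in> {(fps_X - fps_const a) * f * (fps_X + fps_const a) |f. f \<in> series S}"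
    unfolding mem_Collect_eq using series_X_mult[OF assms f(1)] by (intro exI conjI)
qed

text \<open>Reads off the shape of a coefficient of \<open>(X - a) f (X + a)\<close>. A limit element is built from
  finitely many elements of \<open>S\<close>, which later places it in the group generated by three
  conjugates.\<close>

lemma limit_bi_form:
  fixes S :: "'a::ring_1 set"
  assumes "add_subgroup S" "w \<in> limit_bi a S"
  obtains u v e where "u \<in> S" "v \<in> S" "e \<in> S" "w = e + (v * a - a * v) - a * u * a"
proof -
  obtain F n where "F \<in> {(fps_X - fps_const a) * f * (fps_X + fps_const a) | f. f \<in> series S}" "\<And>i. i < n \<Longrightarrow> F $ i = 0" "w = F $ n"
    using assms(2)[unfolded limit_bi_def] by (rule leadE) (rule that; blast)
  then obtain f where f: "f \<in> series S" "w = ((fps_X - fps_const a) * f * (fps_X + fps_const a)) $ n"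
    by auto
  have S: "f $ i \<in> S" for i using f(1) by (simp add: series_def)
  note z = add_subgroup_zero[OF assms(1)]
  show ?thesis
    by (rule that[of "f $ n" "if n < 1 then 0 else f $ (n - 1)" "if n < 2 then 0 else f $ (n - 2)"])
       (use S z in \<open>auto simp: f(2) twist_nth\<close>)
qed

lemma limit_left_subset:
  fixes S W :: "'a::ring_1 set"
  assumes "add_subgroup W" "S \<subseteq> W" "\<And>w. w \<in> W \<Longrightarrow> a * w \<in> W"
  shows "limit_left a S \<subseteq> W"
proof
  fix w assume "w \<in> limit_left a S"
  then obtain F n where "F \<in> {(fps_X - fps_const a) * f | f. f \<in> series S}"
    "\<And>i. i < n \<Longrightarrow> F $ i = 0" "w = F $ n"
    unfolding limit_left_def by (rule leadE) (rule that; blast)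
  then obtain f where f: "f \<in> series S" "w = ((fps_X - fps_const a) * f) $ n"
    by auto
  have "f $ i \<in> W" for i using f(1) assms(2) by (auto simp: series_def)
  then show "w \<in> W"
    using assms(1,3) by (auto simp: f(2) twist_left_nth add_subgroup_rules)
qed

lemma finite_limit_bi:
  fixes S :: "'a::ring_1 set"
  assumes "add_subgroup S" "finite S" shows "finite (limit_bi a S)"
proof (rule finite_subset)
  show "limit_bi a S \<subseteq> (\<lambda>(u, v, e). e + (v * a - a * v) - a * u * a) ` (S \<times> S \<times> S)"
    by (auto elim!: limit_bi_form[OF assms(1)] simp: image_iff)
       (metis SigmaI case_prod_conv)
qed (use assms in auto)

lemma card_limit_bi:
  fixes S :: "'a::ring_1 set"
  assumes "add_subgroup S" "finite S" "a * a = 0"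
  shows "card S \<le> card (limit_bi a S)"
  using finite_limit_bi[OF assms(1,2), of a] unfolding limit_bi_def
proof (rule card_le_card_lead[OF assms(1,2) refl,
      where A' = "fps_X + fps_const a" and B' = "fps_X - fps_const a" and d = 4])
  fix f :: "'a fps"
  have "(fps_X + fps_const a) * ((fps_X - fps_const a) * f * (fps_X + fps_const a)) * (fps_X - fps_const a)
     = ((fps_X + fps_const a) * (fps_X - fps_const a)) * f * ((fps_X + fps_const a) * (fps_X - fps_const a))"
    by (simp only: mult.assoc)
  also have "\<dots> = fps_X ^ 4 * f"
    unfolding square_zero_X[OF assms(3)] mult.assoc fps_X_power_commute[of f]
    by (simp add: mult.assoc[symmetric] flip: power_add)
  finally show "(fps_X + fps_const a) * ((fps_X - fps_const a) * f * (fps_X + fps_const a)) * (fps_X - fps_const a)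
     = fps_X ^ 4 * f" .
qed

lemma card_limit_left:
  fixes S :: "'a::ring_1 set"
  assumes "add_subgroup S" "finite S" "a * a = 0" "finite (limit_left a S)"
  shows "card S \<le> card (limit_left a S)"
  using assms(4) unfolding limit_left_def
proof (rule card_le_card_lead[OF assms(1,2), where A' = "fps_X + fps_const a" and B' = 1 and d = 2
      and A = "fps_X - fps_const a" and B = 1, rotated])
  fix f :: "'a fps"
  show "(fps_X + fps_const a) * ((fps_X - fps_const a) * f * 1) * 1 = fps_X ^ 2 * f"
    using square_zero_X(2)[OF assms(3)] by (simp add: mult.assoc[symmetric])
qed simp

text \<open>The factor \<open>(X + a) (X - a) = X ^ 2\<close> in the middle is central, so products in the family vanish
  if products in \<open>S\<close> do, and so do products of lowest coefficients.\<close>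

lemma limit_bi_mult_zero:
  fixes S :: "'a::ring_1 set"
  assumes "a * a = 0" "\<And>x y. x \<in> S \<Longrightarrow> y \<in> S \<Longrightarrow> x * y = 0" "x \<in> limit_bi a S" "y \<in> limit_bi a S"
  shows "x * y = 0"
proof (rule lead_mult_zero[OF _ assms(3,4)[unfolded limit_bi_def]])
  fix F F' assume "F \<in> {(fps_X - fps_const a) * f * (fps_X + fps_const a) |f. f \<in> series S}"
    "F' \<in> {(fps_X - fps_const a) * f * (fps_X + fps_const a) |f. f \<in> series S}"
  then obtain f g where fg: "f \<in> series S" "g \<in> series S"
    and F: "F = (fps_X - fps_const a) * f * (fps_X + fps_const a)"
      "F' = (fps_X - fps_const a) * g * (fps_X + fps_const a)" by auto
  have "f * g = 0"
    by (rule fps_ext) (use fg in \<open>auto simp: fps_mult_nth series_def assms(2)\<close>)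
  have "F * F' = (fps_X - fps_const a) * f * ((fps_X + fps_const a) * (fps_X - fps_const a)) * g * (fps_X + fps_const a)"
    by (simp only: F mult.assoc)
  also have "\<dots> = fps_X ^ 2 * ((fps_X - fps_const a) * (f * g) * (fps_X + fps_const a))"
    unfolding square_zero_X[OF assms(1)] fps_X_power_commute[of "(fps_X - fps_const a) * f"]
    by (simp only: mult.assoc)
  finally show "F * F' = 0" using \<open>f * g = 0\<close> by simp
qed

lemma limit_bi_left_mult_zero:
  fixes S :: "'a::ring_1 set"
  assumes "a * a = 0" "\<And>x y. x \<in> S \<Longrightarrow> y \<in> C \<Longrightarrow> x * y = 0" "x \<in> limit_bi a S" "y \<in> limit_left a C"
  shows "x * y = 0"
proof (rule lead_mult_zero[OF _ assms(3,4)[unfolded limit_bi_def limit_left_def]])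
  fix F F' assume "F \<in> {(fps_X - fps_const a) * f * (fps_X + fps_const a) |f. f \<in> series S}"
    "F' \<in> {(fps_X - fps_const a) * f |f. f \<in> series C}"
  then obtain f g where fg: "f \<in> series S" "g \<in> series C"
    and F: "F = (fps_X - fps_const a) * f * (fps_X + fps_const a)"
      "F' = (fps_X - fps_const a) * g" by auto
  have "f * g = 0"
    by (rule fps_ext) (use fg in \<open>auto simp: fps_mult_nth series_def assms(2)\<close>)
  have "F * F' = (fps_X - fps_const a) * f * ((fps_X + fps_const a) * (fps_X - fps_const a)) * g"
    by (simp only: F mult.assoc)
  also have "\<dots> = fps_X ^ 2 * ((fps_X - fps_const a) * (f * g))"
    unfolding square_zero_X[OF assms(1)] fps_X_power_commute[of "(fps_X - fps_const a) * f"]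
    by (simp only: mult.assoc)
  finally show "F * F' = 0" using \<open>f * g = 0\<close> by simp
qed

text \<open>Conjugating the family by \<open>1 + r a\<close> amounts to a translation of \<open>t\<close>; this is the infinitesimal
  version. Applying \<open>X ^ 2 * d/dX\<close> to \<open>f\<close> alone stays within the family, and up to terms of higher
  order in \<open>X\<close> it gives the negative of the bracket of \<open>a\<close> with \<open>F\<close>.\<close>

lemma twist_deriv:
  fixes a :: "'a::ring_1" and f :: "'a fps"
  assumes a: "a * a = 0"
  defines "F \<equiv> (fps_X - fps_const a) * f * (fps_X + fps_const a)"
    and "F' \<equiv> (fps_X - fps_const a) * (fps_X ^ 2 * fps_deriv f) * (fps_X + fps_const a)"
  shows "F' $ i = (if i = 0 then 0 else (of_nat i - 3) * F $ (i - 1)) - (a * F $ i - F $ i * a)"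
proof -
  have aa: "a * (a * x) = 0" for x using a by (metis mult.assoc mult_zero_left)
  have "(3::'a) = 1 + (1 + 1)" by simp
  then have three: "3 * x = x + (x + x)" for x :: 'a by (simp only: distrib_right mult_1_left)
  have d: "(fps_X ^ 2 * fps_deriv f) $ j = (if j < 2 then 0 else of_nat (j - 1) * f $ (j - 1))" for j
  proof (cases "j < 2")
    case False
    then obtain k where "j = k + 2" by (metis le_add_diff_inverse2 not_less)
    then show ?thesis by (simp only: fps_X_power_mult_nth) simp
  qed (simp add: fps_X_power_mult_nth)
  have comm: "x * (of_nat k * y) = of_nat k * (x * y)" for x y :: 'a and k
    by (simp only: mult.assoc[symmetric] mult_of_nat_commute[of k x])
  consider "i = 0" | "i = 1" | "i = 2" | "i = Suc (Suc (Suc (i - 3)))"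
    by arith
  then show ?thesis
  proof cases
    case 4
    then obtain k where "i = Suc (Suc (Suc k))" ..
    then show ?thesis unfolding F_def F'_def twist_nth d
      by (simp add: ring_distribs a aa comm mult.assoc three)
  qed (unfold F_def F'_def twist_nth d, simp_all add: ring_distribs a aa mult.assoc numeral_2_eq_2 mult_2)
qed

text \<open>If \<open>F = X ^ n * (w + \<dots>)\<close> belongs to the family, then the differentiated member of the family
  has lowest coefficient \<open>- (a w - w a)\<close> at the same order \<open>n\<close>.\<close>

lemma limit_bi_bracket:
  fixes S :: "'a::ring_1 set"
  assumes S: "add_subgroup S" and a: "a * a = 0" and w: "w \<in> limit_bi a S"
  shows "a * w - w * a \<in> limit_bi a S"
proof -
  let ?N = "{(fps_X - fps_const a) * f * (fps_X + fps_const a) | f. f \<in> series S}"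
  obtain F n where F: "F \<in> ?N" "\<And>i. i < n \<Longrightarrow> F $ i = 0" "w = F $ n"
    using w[unfolded limit_bi_def] by (rule leadE) (rule that; blast)
  then obtain f where f: "f \<in> series S" "F = (fps_X - fps_const a) * f * (fps_X + fps_const a)"
    by auto
  let ?F' = "(fps_X - fps_const a) * (fps_X ^ 2 * fps_deriv f) * (fps_X + fps_const a)"
  note F' = twist_deriv[OF a, of f, folded f(2)]
  have "fps_deriv f \<in> series S"
    using f(1) add_subgroup_of_nat[OF S, of _ "Suc _"] by (simp add: series_def)
  then have "?F' \<in> ?N"
    unfolding mem_Collect_eq
    by (intro exI[of _ "fps_X ^ 2 * fps_deriv f"] conjI refl series_X_mult[OF S])
  then have "?F' $ n \<in> limit_bi a S"
    unfolding limit_bi_def by (rule leadI) (auto simp: F' F(2))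
  also have "?F' $ n = - (a * w - w * a)"
    by (auto simp: F' F)
  finally show ?thesis using add_subgroup_minus[OF limit_bi_subgroup[OF S]] by fastforce
qed

lemma torsion_mult:
  fixes x :: "'a::ring_1"
  assumes "of_nat p * x = 0"
  shows "of_nat p * (x * y) = 0" "of_nat p * (y * x) = 0"
proof -
  show "of_nat p * (x * y) = 0" by (simp add: assms flip: mult.assoc)
  have "of_nat p * (y * x) = y * (of_nat p * x)"
    by (simp only: mult.assoc[symmetric] mult_of_nat_commute[of p y])
  then show "of_nat p * (y * x) = 0" by (simp add: assms)
qed

lemma limit_bi_torsion:
  fixes S :: "'a::ring_1 set"
  assumes "\<And>x. x \<in> S \<Longrightarrow> of_nat p * x = 0" "add_subgroup S" "x \<in> limit_bi a S"
  shows "of_nat p * x = 0"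
proof -
  obtain u v e where uve: "u \<in> S" "v \<in> S" "e \<in> S" and x: "x = e + (v * a - a * v) - a * u * a"
    using limit_bi_form[OF assms(2,3)] .
  show ?thesis
    using assms(1)[OF uve(1)] assms(1)[OF uve(2)] assms(1)[OF uve(3)]
    by (simp add: x right_diff_distrib distrib_left torsion_mult)
qed

text \<open>The limit of a one-parameter family is stable under the one-parameter group. Two brackets with
  \<open>a\<close> give \<open>-2 a w a\<close>, and 2 is invertible, so all terms of the conjugate lie in the limit.\<close>

lemma limit_bi_conj:
  fixes S :: "'a::ring_1 set"
  assumes S: "add_subgroup S" and a: "a * a = 0" and w: "w \<in> limit_bi a S"
    and p: "prime p" "p \<ge> 5" and tor: "\<And>x. x \<in> S \<Longrightarrow> of_nat p * x = 0"
  shows "(1 + a) * w * (1 - a) \<in> limit_bi a S"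
proof -
  note L = limit_bi_subgroup[OF S, of a] and br = limit_bi_bracket[OF S a]
  have aa: "a * (a * x) = 0" for x using a by (metis mult.assoc mult_zero_left)
  have "a * (a * w - w * a) - (a * w - w * a) * a \<in> limit_bi a S" by (intro br w)
  also have "a * (a * w - w * a) - (a * w - w * a) * a = - (of_nat 2 * (a * w * a))"
    unfolding of_nat_numeral mult_2 by (simp add: ring_distribs aa a mult.assoc)
  finally have 2: "of_nat 2 * (a * w * a) \<in> limit_bi a S"
    using add_subgroup_minus[OF L] by fastforce
  have "of_nat p * (a * w * a) = 0" by (intro torsion_mult limit_bi_torsion[OF tor S w])
  then have "a * w * a \<in> limit_bi a S"
    using torsion_divide_dvd[OF L p(1) prime_ge_5_not_dvd(1)[OF p] _ 2] by simp
  then have "w + (a * w - w * a) - a * w * a \<in> limit_bi a S"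
    by (intro add_subgroup_rules[OF L] br w)
  then show ?thesis by (simp add: ring_distribs mult.assoc algebra_simps)
qed

text \<open>When does \<open>w \<mapsto> g w h\<close> preserve the limit? Transported back along the family, this map becomes
  conjugation by a conjugate of \<open>g\<close>, hence a polynomial of degree four in \<open>t\<close>. If its values at
  the integers \<open>0, \<dots>, 4\<close> preserve \<open>S\<close>, interpolation shows that its coefficients do, so it
  also preserves \<open>S\<close> over the power series. This is where five
  distinct residues are essential.\<close>

lemma limit_bi_conj_interpolated:
  fixes S :: "'a::ring_1 set"
  assumes S: "add_subgroup S" and a: "a * a = 0" and w: "w \<in> limit_bi a S"
    and p: "prime p" "p \<ge> 5" and tor: "\<And>x. x \<in> S \<Longrightarrow> of_nat p * x = 0"
    and conj: "\<And>t e. t \<le> 4 \<Longrightarrow> e \<in> S \<Longrightarrow>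
      ((1 + of_nat t * a) * g * (1 - of_nat t * a)) * e * ((1 + of_nat t * a) * h * (1 - of_nat t * a)) \<in> S"
  shows "g * w * h \<in> limit_bi a S"
proof -
  define g1 g2 h1 h2 where "g1 = a * g - g * a" and "g2 = - (a * g * a)"
    and "h1 = a * h - h * a" and "h2 = - (a * h * a)"
  note defs = g1_def g2_def h1_def h2_def
  have c: "g * e * h \<in> S" "g1 * e * h + g * e * h1 \<in> S"
      "g2 * e * h + g1 * e * h1 + g * e * h2 \<in> S" "g2 * e * h1 + g1 * e * h2 \<in> S" "g2 * e * h2 \<in> S"
    if e: "e \<in> S" for e
  proof -
    have t: "of_nat p * (x * e * y) = 0" for x y by (intro torsion_mult tor e)
    have val: "g * e * h + of_nat t * (g1 * e * h + g * e * h1)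
        + of_nat (t\<^sup>2) * (g2 * e * h + g1 * e * h1 + g * e * h2)
        + of_nat (t ^ 3) * (g2 * e * h1 + g1 * e * h2) + of_nat (t ^ 4) * (g2 * e * h2) \<in> S"
      if "t \<le> 4" for t
    proof -
      define T where "T = (of_nat t :: 'a)"
      have T: "y * T = T * y" "y * (T * z) = T * (y * z)" if "y \<in> {a, g, h, e, g1, g2, h1, h2}" for y z
      proof -
        show "y * T = T * y" unfolding T_def by (rule mult_of_nat_commute[symmetric])
        then show "y * (T * z) = T * (y * z)" by (simp flip: mult.assoc)
      qed
      note T' = T[of a, simplified] T[of g, simplified] T[of h, simplified] T[of e, simplified]
        T[of g1, simplified] T[of g2, simplified] T[of h1, simplified] T[of h2, simplified]
      have pow: "of_nat (t\<^sup>2) = T * T" "of_nat (t ^ 3) = T * (T * T)" "of_nat (t ^ 4) = T * (T * (T * T))"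
        by (simp_all add: T_def power2_eq_square power3_eq_cube power4_eq_xxxx mult.assoc)
      have "(1 + T * a) * g * (1 - T * a) = g + T * g1 + T * T * g2"
        by (simp add: g1_def g2_def ring_distribs mult.assoc T')
      moreover have "(1 + T * a) * h * (1 - T * a) = h + T * h1 + T * T * h2"
        by (simp add: h1_def h2_def ring_distribs mult.assoc T')
      ultimately have "(g + T * g1 + T * T * g2) * e * (h + T * h1 + T * T * h2) \<in> S"
        using conj[OF that e] by (simp add: T_def)
      also have "(g + T * g1 + T * T * g2) * e * (h + T * h1 + T * T * h2) =
        g * e * h + T * (g1 * e * h + g * e * h1)
        + (T * T) * (g2 * e * h + g1 * e * h1 + g * e * h2)
        + (T * (T * T)) * (g2 * e * h1 + g1 * e * h2) + (T * (T * (T * T))) * (g2 * e * h2)"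
        by (simp add: ring_distribs mult.assoc T')
      finally show ?thesis unfolding pow T_def[symmetric] .
    qed
    show "g * e * h \<in> S" "g1 * e * h + g * e * h1 \<in> S"
      "g2 * e * h + g1 * e * h1 + g * e * h2 \<in> S" "g2 * e * h1 + g1 * e * h2 \<in> S" "g2 * e * h2 \<in> S"
      by (rule coefficients_in_subgroup[OF S p _ _ _ _ val]; simp add: distrib_left t)+
  qed
  let ?N = "{(fps_X - fps_const a) * f * (fps_X + fps_const a) | f. f \<in> series S}"
  let ?c = "fps_const :: 'a \<Rightarrow> 'a fps"
  let ?X = "fps_X :: 'a fps"
  obtain F n where F: "F \<in> ?N" "\<And>i. i < n \<Longrightarrow> F $ i = 0" "w = F $ n"
    using w[unfolded limit_bi_def] by (rule leadE) (rule that; blast)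
  then obtain f where f: "f \<in> series S" "F = (?X - ?c a) * f * (?X + ?c a)"
    by auto
  (* f' is f transported by g and h along the family; applying the family to f' gives
     X^4 g F h, whose lowest coefficient is g w h. *)
  define f' where "f' = ((?X + ?c a) * ?c g * (?X - ?c a)) * f * ((?X + ?c a) * ?c h * (?X - ?c a))"
  have sh: "(?X + ?c a) * ?c g * (?X - ?c a) = ?X ^ 2 * ?c g + ?X * ?c g1 + ?c g2"
    if "g1 = a * g - g * a" "g2 = - (a * g * a)" for g g1 g2
  proof -
    have "?c a * ?X = ?X * ?c a" "?c g * ?X = ?X * ?c g" "?c a * (?X * ?c g) = ?X * (?c a * ?c g)"
       "?c a * (?c g * ?X) = ?X * (?c a * ?c g)"
      by (metis fps_mult_fps_X_commute mult.assoc)+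
    then show ?thesis
      by (simp add: that ring_distribs power2_eq_square mult.assoc fps_const_mult[symmetric] fps_const_sub[symmetric] fps_const_neg[symmetric]
         del: fps_const_mult fps_const_sub fps_const_neg)
  qed
  have "f' = ?X ^ 4 * (?c g * f * ?c h) + ?X ^ 3 * (?c g1 * f * ?c h + ?c g * f * ?c h1)
    + ?X ^ 2 * (?c g2 * f * ?c h + ?c g1 * f * ?c h1 + ?c g * f * ?c h2)
    + ?X * (?c g2 * f * ?c h1 + ?c g1 * f * ?c h2) + ?c g2 * f * ?c h2"
  proof -
    define Y where "Y = ?X"
    have Y: "z * Y = Y * z" for z unfolding Y_def by (rule fps_mult_fps_X_commute[symmetric])
    have Y2: "z * (Y * y) = Y * (z * y)" for z y using Y by (simp flip: mult.assoc)
    note Y' = Y[of "?c g"] Y[of "?c g1"] Y[of "?c g2"] Y[of f] Y2[of "?c g"] Y2[of "?c g1"] Y2[of "?c g2"] Y2[of f]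
    have pow: "Y ^ 2 = Y * Y" "Y ^ 3 = Y * (Y * Y)" "Y ^ 4 = Y * (Y * (Y * Y))"
      by (simp_all add: power2_eq_square power3_eq_cube power4_eq_xxxx mult.assoc)
    show ?thesis
      unfolding f'_def sh[OF g1_def g2_def] sh[OF h1_def h2_def]
      unfolding Y_def[symmetric] pow
      by (simp add: ring_distribs mult.assoc Y')
  qed
  then have f'n: "f' $ k = (if k < 4 then 0 else g * f $ (k - 4) * h)
    + (if k < 3 then 0 else g1 * f $ (k - 3) * h + g * f $ (k - 3) * h1)
    + (if k < 2 then 0 else g2 * f $ (k - 2) * h + g1 * f $ (k - 2) * h1 + g * f $ (k - 2) * h2)
    + (if k = 0 then 0 else g2 * f $ (k - 1) * h1 + g1 * f $ (k - 1) * h2) + g2 * f $ k * h2" for k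
    by (simp add: fps_X_power_mult_nth)
  have "f' \<in> series S"
    unfolding series_def mem_Collect_eq
  proof
    fix k
    have fS: "f $ i \<in> S" for i using f(1) by (simp add: series_def)
    have z: "(if b then 0 else x) \<in> S" if "x \<in> S" for b x using that add_subgroup_zero[OF S] by simp
    show "f' $ k \<in> S" unfolding f'n by (intro add_subgroup_add[OF S] z c fS)
  qed
  then have "(?X - ?c a) * f' * (?X + ?c a) \<in> ?N" by blast
  also have "(?X - ?c a) * f' * (?X + ?c a) =
     ((?X - ?c a) * (?X + ?c a)) * ?c g * F * ?c h * ((?X - ?c a) * (?X + ?c a))"
    unfolding f'_def f(2) by (simp only: mult.assoc)
  also have "\<dots> = ?X ^ 2 * (?X ^ 2 * (?c g * F * ?c h))"
    unfolding square_zero_X[OF a] fps_X_power_commute[of "?X ^ 2 * ?c g * F * ?c h"] by (simp only: mult.assoc)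
  also have "\<dots> = ?X ^ 4 * (?c g * F * ?c h)" by (simp add: mult.assoc[symmetric] flip: power_add)
  finally show ?thesis
    unfolding limit_bi_def by (rule leadI[where n = "n + 4"]) (auto simp: fps_X_power_mult_nth F)
qed

text \<open>Replacing \<open>u\<close> by \<open>-u\<close> separates the linear and the quadratic part of
  \<open>(1 + u) v (1 - u)\<close>. So the commutator lies in both sets, and therefore it is annihilated by
  \<open>u\<close> and by \<open>v\<close>.\<close>

lemma mutual_normalization:
  fixes S T :: "'a::ring_1 set"
  assumes S: "add_subgroup S" and T: "add_subgroup T" and p: "prime p" "p \<ge> 5"
    and torS: "\<And>x. x \<in> S \<Longrightarrow> of_nat p * x = 0"
    and sqS: "\<And>x y. x \<in> S \<Longrightarrow> y \<in> S \<Longrightarrow> x * y = 0" and sqT: "\<And>x y. x \<in> T \<Longrightarrow> y \<in> T \<Longrightarrow> x * y = 0"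
    and ST: "\<And>u v. u \<in> S \<Longrightarrow> v \<in> T \<Longrightarrow> (1 + u) * v * (1 - u) \<in> T"
    and TS: "\<And>u v. u \<in> S \<Longrightarrow> v \<in> T \<Longrightarrow> (1 + v) * u * (1 - v) \<in> S"
    and u: "u \<in> S" and v: "v \<in> T"
  shows "u * v - v * u \<in> S \<inter> T" "u * v * u = 0" "v * u * v = 0"
proof -
  have half: "x * y - y * x \<in> B"
    if A: "add_subgroup A" and B: "add_subgroup B" and xy: "x \<in> A" "y \<in> B" and tor: "of_nat p * x = 0"
      and AB: "\<And>u v. u \<in> A \<Longrightarrow> v \<in> B \<Longrightarrow> (1 + u) * v * (1 - u) \<in> B" for A B and x y :: 'a
  proof -
    have "(1 + x) * y * (1 - x) - (1 + - x) * y * (1 - - x) \<in> B"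
      by (intro add_subgroup_diff[OF B] AB add_subgroup_minus[OF A] xy)
    also have "(1 + x) * y * (1 - x) - (1 + - x) * y * (1 - - x) = of_nat 2 * (x * y - y * x)"
      unfolding of_nat_numeral mult_2 by (simp add: ring_distribs mult.assoc)
    finally have 2: "of_nat 2 * (x * y - y * x) \<in> B" .
    show ?thesis
      by (rule torsion_divide_dvd[OF B p(1) prime_ge_5_not_dvd(1)[OF p] _ 2])
         (simp add: right_diff_distrib torsion_mult[OF tor])
  qed
  have "v * u - u * v \<in> S"
  proof -
    have "(1 + v) * u * (1 - v) - (1 + - v) * u * (1 - - v) \<in> S"
      by (intro add_subgroup_diff[OF S] TS add_subgroup_minus[OF T] u v)
    also have "(1 + v) * u * (1 - v) - (1 + - v) * u * (1 - - v) = of_nat 2 * (v * u - u * v)"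
      unfolding of_nat_numeral mult_2 by (simp add: ring_distribs mult.assoc)
    finally have 2: "of_nat 2 * (v * u - u * v) \<in> S" .
    show ?thesis
      by (rule torsion_divide_dvd[OF S p(1) prime_ge_5_not_dvd(1)[OF p] _ 2])
         (simp add: right_diff_distrib torsion_mult[OF torS[OF u]])
  qed
  then have cS: "u * v - v * u \<in> S" using add_subgroup_minus[OF S] by fastforce
  moreover have cT: "u * v - v * u \<in> T" by (rule half[OF S T u v torS[OF u] ST])
  ultimately show "u * v - v * u \<in> S \<inter> T" by simp
  have "u * (u * v - v * u) = 0" using sqS[OF u cS] .
  moreover have "u * (u * v) = 0" using sqS[OF u u] by (simp flip: mult.assoc)
  ultimately show "u * v * u = 0" by (simp add: right_diff_distrib mult.assoc)
  have "v * (u * v - v * u) = 0" using sqT[OF v cT] .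
  moreover have "v * (v * u) = 0" using sqT[OF v v] by (simp flip: mult.assoc)
  ultimately show "v * u * v = 0" by (simp add: right_diff_distrib mult.assoc)
qed

text \<open>A product formula of Baker-Campbell-Hausdorff type: here \<open>k\<close> plays the role of \<open>1/2\<close>. The equation
  \<open>w * w = 0\<close> for \<open>w = u0 + u1 + u2\<close> forces \<open>u0 u1 u2\<close> to change sign under every
  transposition of the factors, and with this all terms of degree three cancel. So no third-order
  corrections are needed: \<open>1 + w\<close> is a product of six factors that involve only the summands and
  half of their commutators.\<close>

lemma exp_three_factors:
  fixes u0 u1 u2 :: "'a::ring_1"
  assumes sq: "u0 * u0 = 0" "u1 * u1 = 0" "u2 * u2 = 0"
    and tri: "u0 * u1 * u0 = 0" "u1 * u0 * u1 = 0" "u0 * u2 * u0 = 0" "u2 * u0 * u2 = 0"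
      "u1 * u2 * u1 = 0" "u2 * u1 * u2 = 0"
    and w: "(u0 + u1 + u2) * (u0 + u1 + u2) = 0"
    and k: "\<And>x. of_nat p * x = 0 \<Longrightarrow> k * (x + x) = x" and kc: "\<And>x. k * x = x * k"
    and tor: "of_nat p * u0 = 0" "of_nat p * u1 = 0" "of_nat p * u2 = 0"
  shows "(1 + u0) * (1 + u1) * (1 + u2) * (1 - k * (u0 * u1 - u1 * u0)) *
    (1 - k * (u0 * u2 - u2 * u0)) * (1 - k * (u1 * u2 - u2 * u1)) = 1 + (u0 + u1 + u2)"
proof -
  define z where "z = u0 * (u1 * u2)"
  have sq': "u0 * (u0 * x) = 0" "u1 * (u1 * x) = 0" "u2 * (u2 * x) = 0" for x
    using sq by (simp_all flip: mult.assoc)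
  have tri': "u0 * (u1 * u0) = 0" "u1 * (u0 * u1) = 0" "u0 * (u2 * u0) = 0" "u2 * (u0 * u2) = 0"
      "u1 * (u2 * u1) = 0" "u2 * (u1 * u2) = 0"
    using tri by (simp_all add: mult.assoc)
  have tri'': "u0 * (u1 * (u0 * x)) = 0" "u1 * (u0 * (u1 * x)) = 0" "u0 * (u2 * (u0 * x)) = 0"
      "u2 * (u0 * (u2 * x)) = 0" "u1 * (u2 * (u1 * x)) = 0" "u2 * (u1 * (u2 * x)) = 0" for x
    using tri by (simp_all flip: mult.assoc)
  note zero = sq sq' tri' tri''
  have w': "u0 * u1 + u1 * u0 + u0 * u2 + u2 * u0 + u1 * u2 + u2 * u1 = 0" (is "?w = 0")
    using w by (simp add: ring_distribs sq algebra_simps)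
  have l: "u0 * ?w = 0" "u1 * ?w = 0" "?w * u2 = 0" "?w * u1 = 0" "?w * u0 = 0"
    by (simp_all add: w')
  have p021: "u0 * (u2 * u1) = - z" using l(1) by (simp add: ring_distribs zero z_def mult.assoc eq_neg_iff_add_eq_0 add.commute)
  have p102: "u1 * (u0 * u2) = - z" using l(3) by (simp add: ring_distribs zero z_def mult.assoc eq_neg_iff_add_eq_0 add.commute)
  have p120: "u1 * (u2 * u0) = z" using l(2) p102 by (simp add: ring_distribs zero mult.assoc)
  have p201: "u2 * (u0 * u1) = z" using l(4) p021 by (simp add: ring_distribs zero mult.assoc)
  have p210: "u2 * (u1 * u0) = - z" using l(5) p120 by (simp add: ring_distribs zero mult.assoc eq_neg_iff_add_eq_0 add.commute)
  have p012: "u0 * (u1 * u2) = z" by (simp add: z_def)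
  note perm = p012 p021 p102 p120 p201 p210
  have z0: "u0 * z = 0" "z * u2 = 0" by (simp_all add: z_def zero mult.assoc)
  have z1: "u1 * z = 0" by (simp add: p120[symmetric] zero)
  have z2: "u2 * z = 0" by (simp add: p201[symmetric] zero)
  have z3: "z * u0 = 0" by (simp add: p120[symmetric] zero mult.assoc)
  have z4: "z * u1 = 0" by (simp add: p201[symmetric] zero mult.assoc)
  have zx: "z * (u0 * x) = 0" "z * (u1 * x) = 0" "z * (u2 * x) = 0" for x
    using z0 z3 z4 by (simp_all flip: mult.assoc)
  note zz = z0 z1 z2 z3 z4 zx
  define c01 c02 c12 where "c01 = u0 * u1 - u1 * u0" and "c02 = u0 * u2 - u2 * u0" and "c12 = u1 * u2 - u2 * u1"
  define q where "q = u0 * u1 + u0 * u2 + u1 * u2"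
  have cc: "c01 * c02 = 0" "c01 * c12 = 0" "c02 * c12 = 0"
    by (simp_all add: c01_def c02_def c12_def ring_distribs mult.assoc zero perm zz)
  have kk: "(k * x) * (k * y) = k * (k * (x * y))" for x y
    by (metis kc mult.assoc)
  have "(1 - k * c01) * (1 - k * c02) * (1 - k * c12) = 1 - k * (c01 + c02 + c12)"
    by (simp add: ring_distribs kk cc mult.assoc)
       (simp add: kk[unfolded mult.assoc] cc)
  also have "c01 + c02 + c12 = q + q - ?w"
    by (simp add: c01_def c02_def c12_def q_def algebra_simps)
  also have "k * (q + q - ?w) = q" 
    using k[of q] by (simp add: w' q_def distrib_left torsion_mult tor)
  finally have D: "(1 - k * c01) * (1 - k * c02) * (1 - k * c12) = 1 - q" .
  have "(1 + u0) * (1 + u1) * (1 + u2) * (1 - k * c01) * (1 - k * c02) * (1 - k * c12)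
    = (1 + u0) * (1 + u1) * (1 + u2) * (1 - q)"
    unfolding D[symmetric] by (simp only: mult.assoc)
  also have "\<dots> = 1 + (u0 + u1 + u2)"
    by (simp add: q_def ring_distribs mult.assoc zero perm zz)
  finally show ?thesis by (simp only: c01_def c02_def c12_def)
qed

section \<open>Normalizers in finite p-groups\<close>

text \<open>Orbits of a \<open>p\<close>-group that are not single points have size divisible by \<open>p\<close>.\<close>

lemma (in group_action) dvd_card_fixed_point_free:
  assumes p: "prime p" "order G = p ^ n" and C: "finite C" "C \<subseteq> E"
    and closed: "\<And>g x. g \<in> carrier G \<Longrightarrow> x \<in> C \<Longrightarrow> \<phi> g x \<in> C"
    and no_fix: "\<And>x. x \<in> C \<Longrightarrow> \<exists>g\<in>carrier G. \<phi> g x \<noteq> x"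
  shows "p dvd card C"
proof -
  let ?P = "orbit G \<phi> ` C"
  have sub: "orbit G \<phi> x \<subseteq> C" if "x \<in> C" for x using closed that by (auto simp: orbit_def)
  have un: "\<Union> ?P = C" using sub orbit_refl C(2) by (auto simp: subset_iff)
  have "p dvd card (\<Union> ?P)"
  proof (rule dvd_partition)
    show "finite (\<Union> ?P)" using un C(1) by simp
    show "\<forall>c\<in>?P. p dvd card c"
    proof
      fix c assume "c \<in> ?P"
      then obtain x where x: "x \<in> C" "c = orbit G \<phi> x" by auto
      then have xE: "x \<in> E" using C(2) by auto
      have "card c dvd p ^ n"
        using orbit_stabilizer_theorem[OF xE] p(2) x(2) by (metis dvd_triv_left)
      then obtain i where i: "card c = p ^ i" using divides_primepow_nat[OF p(1)] by auto
      obtain g where g: "g \<in> carrier G" "\<phi> g x \<noteq> x" using no_fix[OF x(1)] by auto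
      have "i \<noteq> 0"
      proof
        assume "i = 0"
        then obtain y where "c = {y}" using i card_1_singletonE by auto
        moreover have "x \<in> c" "\<phi> g x \<in> c" using x(2) orbit_refl[OF xE] g(1) by (auto simp: orbit_def)
        ultimately show False using g(2) by auto
      qed
      then show "p dvd card c" using i by simp
    qed
    show "\<forall>c1\<in>?P. \<forall>c2\<in>?P. c1 \<noteq> c2 \<longrightarrow> c1 \<inter> c2 = {}"
      using disjoint_union C(2) unfolding orbits_def by blast
  qed
  then show ?thesis by (simp only: un)
qed

text \<open>For finite \<open>E\<close> the inclusion is an equality, so this is the normalizer.\<close>

definition normalizing :: "('a, 'b) monoid_scheme \<Rightarrow> 'a set \<Rightarrow> 'a set" where
  "normalizing G E = {g \<in> carrier G. \<forall>e\<in>E. g \<otimes>\<^bsub>G\<^esub> e \<otimes>\<^bsub>G\<^esub> inv\<^bsub>G\<^esub> g \<in> E}"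

lemma (in group) inv_cancel:
  assumes "g \<in> carrier G" "x \<in> carrier G"
  shows "g \<otimes> (inv g \<otimes> x) = x" "inv g \<otimes> (g \<otimes> x) = x"
  using assms by (simp_all flip: m_assoc)

lemma (in group) conj_mult:
  assumes "g \<in> carrier G" "h \<in> carrier G" "e \<in> carrier G"
  shows "(g \<otimes> h) \<otimes> e \<otimes> inv (g \<otimes> h) = g \<otimes> (h \<otimes> e \<otimes> inv h) \<otimes> inv g"
  using assms by (simp add: inv_mult_group m_assoc)

lemma (in group) inj_on_conj:
  assumes "g \<in> carrier G"
  shows "inj_on (\<lambda>e. g \<otimes> e \<otimes> inv g) (carrier G)"
  by (rule inj_onI) (use assms in auto)

lemma (in group) subgroup_normalizing:
  assumes "finite E" "E \<subseteq> carrier G"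
  shows "subgroup (normalizing G E) G"
proof (rule subgroupI)
  show "normalizing G E \<subseteq> carrier G" by (auto simp: normalizing_def)
  show "normalizing G E \<noteq> {}"
    using assms by (auto simp: normalizing_def subset_iff intro!: exI[of _ \<one>])
next
  fix g assume g: "g \<in> normalizing G E"
  then have gc: "g \<in> carrier G" by (auto simp: normalizing_def)
  have "(\<lambda>e. g \<otimes> e \<otimes> inv g) ` E = E"
    by (rule endo_inj_surj[OF assms(1)])
       (use g inj_on_subset[OF inj_on_conj[OF gc] assms(2)] in \<open>auto simp: normalizing_def\<close>)
  moreover have "inv g \<otimes> (g \<otimes> e \<otimes> inv g) \<otimes> inv (inv g) = e" if "e \<in> E" for e
    using gc that assms(2) by (simp add: m_assoc inv_cancel subset_iff)
  ultimately have "inv g \<otimes> e \<otimes> inv (inv g) \<in> E" if "e \<in> E" for e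
    using that by (metis (no_types, lifting) imageE)
  then show "inv g \<in> normalizing G E" using gc by (simp add: normalizing_def)
next
  fix g h assume "g \<in> normalizing G E" "h \<in> normalizing G E"
  then show "g \<otimes> h \<in> normalizing G E"
    using assms(2) by (auto simp: normalizing_def subset_iff conj_mult)
qed

text \<open>A version of the growth of normalizers in \<open>p\<close>-groups that keeps track of a conjugation invariant
  generating set \<open>Q\<close>. The group \<open>K\<close> acts by conjugation on the conjugates of \<open>K\<close>. If \<open>K\<close> is
  not normal, their number is a positive power of \<open>p\<close>, so besides \<open>K\<close> itself there is
  another fixed conjugate \<open>g K g\<^sup>-\<^sup>1\<close>. Then \<open>g\<^sup>-\<^sup>1 K g\<close> normalizes \<open>K\<close> and is generated by
  elements of \<open>Q\<close>, which cannot all lie in \<open>K\<close>.\<close>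

lemma (in group) exists_normalizing_generator:
  assumes p: "prime p" "order G = p ^ n" and fin: "finite (carrier G)"
    and K: "subgroup K G" and Q: "Q \<subseteq> carrier G"
    and Q_conj: "\<And>g x. g \<in> carrier G \<Longrightarrow> x \<in> Q \<Longrightarrow> g \<otimes> x \<otimes> inv g \<in> Q"
    and gen: "K = generate G (Q \<inter> K)" and "\<not> Q \<subseteq> K"
  shows "\<exists>x\<in>Q. x \<notin> K \<and> x \<in> normalizing G K"
proof -
  interpret K: subgroup K G by (rule K)
  define \<phi> where "\<phi> = (\<lambda>g. \<lambda>H \<in> {H. H \<subseteq> carrier G}. g <# H #> (inv g))"
  interpret act: group_action G "{H. H \<subseteq> carrier G}" \<phi>
    unfolding \<phi>_def by (rule action_by_conjugation_on_power_set)
  have \<phi>: "\<phi> g H = (\<lambda>k. g \<otimes> k \<otimes> inv g) ` H" if "H \<subseteq> carrier G" for g H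
    using that by (auto simp: \<phi>_def l_coset_def r_coset_def image_iff)
  let ?C = "orbit G \<phi> K"
  have Kc: "K \<in> {H. H \<subseteq> carrier G}" using K.subset by simp
  have C: "?C \<subseteq> {H. H \<subseteq> carrier G}"
    using act.element_image Kc unfolding orbit_def by blast
  have finC: "finite ?C" by (rule finite_subset[OF C]) (use fin in auto)
  have KC: "K \<in> ?C" by (rule act.orbit_refl[OF Kc])
  show ?thesis
  proof (cases "?C = {K}")
    case True
    obtain x where x: "x \<in> Q" "x \<notin> K" using \<open>\<not> Q \<subseteq> K\<close> by auto
    have "\<phi> x K \<in> ?C" using x(1) Q by (auto simp: orbit_def)
    then have "\<phi> x K = K" using True by simp
    then have "x \<in> normalizing G K" using x(1) Q \<phi>[OF K.subset] by (auto simp: normalizing_def)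
    then show ?thesis using x by blast
  next
    case False
    have "card ?C dvd p ^ n"
      using act.orbit_stabilizer_theorem[OF Kc] p(2) by (metis dvd_triv_left)
    then obtain i where i: "card ?C = p ^ i" using divides_primepow_nat[OF p(1)] by auto
    have "i \<noteq> 0"
    proof
      assume "i = 0"
      then have "card ?C = 1" using i by simp
      then show False using False KC by (metis card_1_singletonE singletonD)
    qed
    then have pC: "p dvd card ?C" using i by simp
    have "\<not> p dvd card (?C - {K})"
    proof
      assume "p dvd card (?C - {K})"
      moreover have "card ?C = card (?C - {K}) + 1"
        using card.remove[OF finC KC] by simp
      ultimately have "p dvd 1" using pC dvd_add_right_iff by metis
      then show False using p(1) by (simp add: prime_nat_iff)
    qed
    interpret Kact: group_action "G\<lparr>carrier := K\<rparr>" "{H. H \<subseteq> carrier G}" \<phi>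
      by (rule act.induced_action[OF K])
    have "card K dvd p ^ n" using lagrange[OF K] p(2) by (metis dvd_triv_right)
    then obtain j where j: "card K = p ^ j" using divides_primepow_nat[OF p(1)] by auto
    have "\<exists>H\<in>?C - {K}. \<forall>k\<in>K. \<phi> k H = H"
    proof (rule ccontr)
      assume no: "\<not> ?thesis"
      have "p dvd card (?C - {K})"
      proof (rule Kact.dvd_card_fixed_point_free[OF p(1)])
        show "order (G\<lparr>carrier := K\<rparr>) = p ^ j" using j by (simp add: order_def)
        show "finite (?C - {K})" using finC by simp
        show "?C - {K} \<subseteq> {H. H \<subseteq> carrier G}" using C by blast
        show "\<exists>g\<in>carrier (G\<lparr>carrier := K\<rparr>). \<phi> g x \<noteq> x" if "x \<in> ?C - {K}" for x
          using no that by auto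
        fix k H assume "k \<in> carrier (G\<lparr>carrier := K\<rparr>)" and H: "H \<in> ?C - {K}"
        then have k: "k \<in> K" by simp
        have HE: "H \<in> {H. H \<subseteq> carrier G}" using H C by blast
        have kC: "\<phi> k H \<in> ?C"
        proof (rule act.orbit_trans[OF Kc HE])
          show "\<phi> k H \<in> {H. H \<subseteq> carrier G}" using act.element_image[OF K.mem_carrier[OF k] HE] by blast
          show "\<phi> k H \<in> orbit G \<phi> H" using K.mem_carrier[OF k] by (auto simp: orbit_def)
        qed (use H in auto)
        have "\<phi> k K = K"
        proof -
          have "k \<otimes> x \<otimes> inv k \<in> K" if "x \<in> K" for x using k that by simp
          then have "\<phi> k K \<subseteq> K" using \<phi>[OF K.subset] by auto
          moreover have "card (\<phi> k K) = card K"
            using \<phi>[OF K.subset] card_image[OF inj_on_subset[OF inj_on_conj[OF K.mem_carrier[OF k]] K.subset]] by simp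
          ultimately show ?thesis using card_subset_eq finite_subset[OF K.subset fin] by blast
        qed
        then have "\<phi> k H \<noteq> K"
          using act.inj_prop[OF K.mem_carrier[OF k]] Kc HE H by (metis DiffD2 inj_onD singletonI)
        then show "\<phi> k H \<in> ?C - {K}" using kC by simp
      qed
      then show False using \<open>\<not> p dvd card (?C - {K})\<close> by simp
    qed
    then obtain g where g: "g \<in> carrier G" and ne: "\<phi> g K \<noteq> K" and fixed: "\<And>k. k \<in> K \<Longrightarrow> \<phi> k (\<phi> g K) = \<phi> g K"
      unfolding orbit_def by auto
    have gK: "\<phi> g K = (\<lambda>k. g \<otimes> k \<otimes> inv g) ` K" by (rule \<phi>[OF K.subset])
    have gKc: "\<phi> g K \<subseteq> carrier G" unfolding gK using g by auto
    have "\<exists>x\<in>Q \<inter> K. inv g \<otimes> x \<otimes> g \<notin> K"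
    proof (rule ccontr)
      assume "\<not> ?thesis"
      then have all: "\<And>x. x \<in> Q \<inter> K \<Longrightarrow> inv g \<otimes> x \<otimes> g \<in> K" by blast
      let ?H = "(\<lambda>k. g \<otimes> k \<otimes> inv g) ` K"
      have "Q \<inter> K \<subseteq> ?H"
      proof
        fix x assume x: "x \<in> Q \<inter> K"
        have "g \<otimes> (inv g \<otimes> x \<otimes> g) \<otimes> inv g = x" using g x by (simp add: m_assoc inv_cancel)
        then show "x \<in> ?H" using all[OF x] by (metis imageI)
      qed
      moreover have "subgroup ?H G"
      proof (rule subgroupI)
        show "?H \<subseteq> carrier G" using g by auto
        show "?H \<noteq> {}" using K.one_closed by blast
      next
        fix x assume "x \<in> ?H"
        then obtain k where k: "k \<in> K" "x = g \<otimes> k \<otimes> inv g" by auto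
        then have "inv x = g \<otimes> inv k \<otimes> inv g" using g by (simp add: inv_mult_group m_assoc)
        then show "inv x \<in> ?H" using k(1) by blast
      next
        fix x y assume "x \<in> ?H" "y \<in> ?H"
        then obtain k l where k: "k \<in> K" "x = g \<otimes> k \<otimes> inv g" "l \<in> K" "y = g \<otimes> l \<otimes> inv g" by auto
        then have "x \<otimes> y = g \<otimes> (k \<otimes> l) \<otimes> inv g" using g by (simp add: m_assoc inv_cancel)
        then show "x \<otimes> y \<in> ?H" using k by blast
      qed
      ultimately have "K \<subseteq> ?H" using gen generate_subgroup_incl by metis
      moreover have "card ?H = card K" by (rule card_image[OF inj_on_subset[OF inj_on_conj[OF g] K.subset]])
      ultimately have "K = ?H" using card_subset_eq[of ?H K] finite_subset[OF K.subset fin] by simp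
      then show False using ne gK by simp
    qed
    then obtain x where x: "x \<in> Q" "x \<in> K" and out: "inv g \<otimes> x \<otimes> g \<notin> K" by blast
    let ?y = "inv g \<otimes> x \<otimes> g"
    have "?y \<in> Q" using Q_conj[of "inv g" x] g x(1) by simp
    moreover have "?y \<in> normalizing G K"
      unfolding normalizing_def
    proof (intro CollectI conjI ballI)
      show yc: "?y \<in> carrier G" using g x by simp
      fix k assume k: "k \<in> K"
      have "x \<otimes> (g \<otimes> k \<otimes> inv g) \<otimes> inv x \<in> \<phi> g K"
        using fixed[OF x(2)] \<phi>[OF gKc, of x] gK k by blast
      then obtain k' where k': "k' \<in> K" "x \<otimes> (g \<otimes> k \<otimes> inv g) \<otimes> inv x = g \<otimes> k' \<otimes> inv g"
        unfolding gK by auto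
      have "?y \<otimes> k \<otimes> inv ?y = inv g \<otimes> (x \<otimes> (g \<otimes> k \<otimes> inv g) \<otimes> inv x) \<otimes> g"
        using g x k by (simp add: m_assoc inv_mult_group)
      also have "\<dots> = k'"
        unfolding k'(2) using g k'(1) by (simp add: m_assoc inv_cancel)
      finally show "?y \<otimes> k \<otimes> inv ?y \<in> K" using k'(1) by simp
    qed
    ultimately show ?thesis using out by blast
  qed
qed

section \<open>Finite p-groups of units\<close>

text \<open>A finite \<open>p\<close>-group of units of a ring, and a finite left module \<open>W\<close> inside the ring that detects
  whether a product of two elements \<open>\<rho> g - 1\<close> vanishes. Having group and module in one ring allows
  power series over that ring to describe limits of both.\<close>

locale p_group_of_units = group G for G (structure) +
  fixes \<rho> :: "'a \<Rightarrow> 'r::ring_1" and p n :: nat and W :: "'r set"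
  assumes fin: "finite (carrier G)" and order_G: "order G = p ^ n"
    and p: "prime p" "p \<ge> 5"
    and rho_mult: "\<And>g h. g \<in> carrier G \<Longrightarrow> h \<in> carrier G \<Longrightarrow> \<rho> (g \<otimes> h) = \<rho> g * \<rho> h"
    and rho_one: "\<rho> \<one> = 1"
    and rho_inj: "inj_on \<rho> (carrier G)"
    and rho_torsion: "\<And>g. g \<in> carrier G \<Longrightarrow> of_nat p * (\<rho> g - 1) = 0"
    and W: "add_subgroup W" "finite W"
    and W_closed: "\<And>g w. g \<in> carrier G \<Longrightarrow> w \<in> W \<Longrightarrow> \<rho> g * w \<in> W"
    and W_faithful: "\<And>g h. g \<in> carrier G \<Longrightarrow> h \<in> carrier G \<Longrightarrow>
      (\<And>w. w \<in> W \<Longrightarrow> (\<rho> g - 1) * ((\<rho> h - 1) * w) = 0) \<Longrightarrow> (\<rho> g - 1) * (\<rho> h - 1) = 0"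
begin

definition fixed :: "'a set \<Rightarrow> 'r set" where
  "fixed E = {w \<in> W. \<forall>e\<in>E. \<rho> e * w = w}"

text \<open>The quadratic offenders. They are automatically elementary abelian: commutativity and exponent \<open>p\<close>
  follow from the vanishing products and from \<open>rho_torsion\<close>.\<close>

definition quad :: "'a set \<Rightarrow> bool" where
  "quad E \<longleftrightarrow> subgroup E G \<and> E \<noteq> {\<one>} \<and> (\<forall>e\<in>E. \<forall>f\<in>E. (\<rho> e - 1) * (\<rho> f - 1) = 0) \<and>
    card W \<le> card E * card (fixed E)"

text \<open>The additive version of \<open>E\<close>. If products of its elements vanish, then multiplication in \<open>E\<close>
  becomes addition.\<close>

definition shift :: "'a set \<Rightarrow> 'r set" where
  "shift E = (\<lambda>e. \<rho> e - 1) ` E"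

lemma rho_inv: "g \<in> carrier G \<Longrightarrow> \<rho> g * \<rho> (inv g) = 1" "g \<in> carrier G \<Longrightarrow> \<rho> (inv g) * \<rho> g = 1"
  using rho_mult[of g "inv g"] rho_mult[of "inv g" g] rho_one by auto

lemma rho_inv_unique: "g \<in> carrier G \<Longrightarrow> \<rho> g * y = 1 \<Longrightarrow> \<rho> (inv g) = y"
  by (metis mult.assoc mult_1_left mult_1_right rho_inv(2))

lemma fixed_subgroup: "add_subgroup (fixed E)"
  using W(1) by (auto simp: add_subgroup_def fixed_def right_diff_distrib)

lemma shift_torsion: "E \<subseteq> carrier G \<Longrightarrow> x \<in> shift E \<Longrightarrow> of_nat p * x = 0"
  using rho_torsion by (auto simp: shift_def)

lemma shift_subgroup:
  assumes E: "subgroup E G" and sq: "\<And>e f. e \<in> E \<Longrightarrow> f \<in> E \<Longrightarrow> (\<rho> e - 1) * (\<rho> f - 1) = 0"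
  shows "add_subgroup (shift E)"
  unfolding add_subgroup_def
proof (intro conjI ballI)
  interpret E: subgroup E G by (rule E)
  show "0 \<in> shift E" using E.one_closed rho_one by (auto simp: shift_def intro!: image_eqI[of _ _ \<one>])
  fix x y assume "x \<in> shift E" "y \<in> shift E"
  then obtain e f where ef: "e \<in> E" "x = \<rho> e - 1" "f \<in> E" "y = \<rho> f - 1" by (auto simp: shift_def)
  have f': "\<rho> (inv f) = 1 - y"
  proof (rule rho_inv_unique)
    have "\<rho> f = 1 + y" "y * y = 0" using ef sq[of f f] by simp_all
    then show "\<rho> f * (1 - y) = 1" by (simp add: ring_distribs)
  qed (use ef in simp)
  have "\<rho> (e \<otimes> inv f) - 1 = (x + 1) * (1 - y) - 1" using ef f' by (simp add: rho_mult)
  also have "x * y = 0" using sq[of e f] ef by simp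
  then have "(x + 1) * (1 - y) - 1 = x - y" by (simp add: ring_distribs)
  finally have "x - y = \<rho> (e \<otimes> inv f) - 1" by simp
  then show "x - y \<in> shift E" using ef by (auto simp: shift_def)
qed

lemma inj_shift: "inj_on (\<lambda>e. \<rho> e - 1) (carrier G)"
  using rho_inj by (auto simp: inj_on_def)

lemma card_shift: "E \<subseteq> carrier G \<Longrightarrow> card (shift E) = card E"
  unfolding shift_def by (rule card_image) (rule inj_on_subset[OF inj_shift])

lemma conj_shift:
  assumes "g \<in> carrier G" "e \<in> carrier G"
  shows "\<rho> g * (\<rho> e - 1) * \<rho> (inv g) = \<rho> (g \<otimes> e \<otimes> inv g) - 1"
  using assms rho_inv by (simp add: rho_mult ring_distribs)

lemma rho_power:
  assumes "x \<in> carrier G" "(\<rho> x - 1) * (\<rho> x - 1) = 0"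
  shows "\<rho> (x [^] t) = 1 + of_nat t * (\<rho> x - 1)" "\<rho> (inv (x [^] t)) = 1 - of_nat t * (\<rho> x - 1)"
proof -
  define a where "a = \<rho> x - 1"
  have a: "a * a = 0" using assms(2) by (simp add: a_def)
  have aa: "of_nat t * a * (of_nat s * a) = 0" for t s :: nat
  proof -
    have "of_nat t * a * (of_nat s * a) = of_nat t * (a * of_nat s) * a" by (simp only: mult.assoc)
    also have "a * of_nat s = of_nat s * a" by (rule mult_of_nat_commute[symmetric])
    finally show ?thesis using a by (simp add: mult.assoc)
  qed
  show 1: "\<rho> (x [^] t) = 1 + of_nat t * (\<rho> x - 1)"
  proof (induction t)
    case (Suc t)
    have "\<rho> (x [^] Suc t) = (1 + of_nat t * a) * (1 + a)"
      using assms(1) Suc by (simp add: rho_mult a_def)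
    also have "\<dots> = 1 + of_nat (Suc t) * a"
      using aa[of t 1] by (simp add: ring_distribs)
    finally show ?case by (simp add: a_def)
  qed (simp add: rho_one)
  show "\<rho> (inv (x [^] t)) = 1 - of_nat t * (\<rho> x - 1)"
    by (rule rho_inv_unique) (use assms(1) aa[of t t] in \<open>simp_all add: 1 ring_distribs a_def[symmetric]\<close>)
qed

lemma conj_subgroup_shift:
  assumes E: "E \<subseteq> carrier G" "add_subgroup (shift E)" and g: "g \<in> carrier G"
  shows "add_subgroup ((\<lambda>s. \<rho> g * s * \<rho> (inv g)) ` shift E)"
  using add_subgroup_linear_image[OF E(2), of "\<lambda>s. \<rho> g * s * \<rho> (inv g)"]
  by (simp add: ring_distribs image_def Bex_def conj_commute)

text \<open>The limit of \<open>E\<close> along \<open>x\<close> consists of elements of the group, although it is defined by formal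
  means. The conjugates of \<open>E\<close> by \<open>1\<close>, \<open>x\<close> and \<open>x\<^sup>2\<close> all lie in \<open>K\<close> and are normal in
  it. A limit element is a sum of three elements, one from each of these conjugates in additive
  form, and its square is zero, so the product formula applies.\<close>

lemma limit_in_group:
  assumes E: "subgroup E G" and sq: "\<And>e f. e \<in> E \<Longrightarrow> f \<in> E \<Longrightarrow> (\<rho> e - 1) * (\<rho> f - 1) = 0"
    and K: "subgroup K G" "E \<subseteq> K" "K \<subseteq> normalizing G E"
    and x: "x \<in> normalizing G K" "(\<rho> x - 1) * (\<rho> x - 1) = 0"
    and w: "w \<in> limit_bi (\<rho> x - 1) (shift E)"
  shows "\<exists>g\<in>carrier G. \<rho> g = 1 + w"
proof -
  interpret E: subgroup E G by (rule E)
  interpret K: subgroup K G by (rule K(1))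
  define a where "a = \<rho> x - 1"
  have xc: "x \<in> carrier G" using x(1) by (auto simp: normalizing_def)
  have a: "a * a = 0" using x(2) by (simp add: a_def)
  have S: "add_subgroup (shift E)" by (rule shift_subgroup[OF E sq])
  have finK: "finite K" by (rule finite_subset[OF K.subset fin])
  interpret N: subgroup "normalizing G K" G by (rule subgroup_normalizing[OF finK K.subset])
  have xt: "x [^] (t::nat) \<in> normalizing G K" for t
    by (induction t) (auto intro: x(1))
  have xt': "inv (x [^] (t::nat)) \<in> normalizing G K" for t using xt by auto
  define c where "c = (\<lambda>(t::nat) s. (1 + of_nat t * a) * s * (1 - of_nat t * a))"
  have c_rho: "c t s = \<rho> (x [^] t) * s * \<rho> (inv (x [^] t))" for t s
    unfolding c_def rho_power[OF xc x(2)] a_def ..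
  define T where "T t = c t ` shift E" for t
  have T: "add_subgroup (T t)" for t
    unfolding T_def c_rho using conj_subgroup_shift[OF E.subset S, of "x [^] t"] xc by simp
  have T_mem: "\<exists>e\<in>E. s = \<rho> (x [^] t \<otimes> e \<otimes> inv (x [^] t)) - 1" if "s \<in> T t" for s t
  proof -
    obtain e where e: "e \<in> E" "s = c t (\<rho> e - 1)" using \<open>s \<in> T t\<close> by (auto simp: T_def shift_def)
    then show ?thesis using conj_shift[of "x [^] t" e] xc by (auto simp: c_rho)
  qed
  have T_K: "\<exists>k\<in>K. s = \<rho> k - 1" if s: "s \<in> T t" for s t
  proof -
    obtain e where e: "e \<in> E" "s = \<rho> (x [^] t \<otimes> e \<otimes> inv (x [^] t)) - 1" using T_mem[OF s] by (elim bexE)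
    have "e \<in> K" using e(1) K(2) by blast
    then have "x [^] t \<otimes> e \<otimes> inv (x [^] t) \<in> K" using xt[of t] unfolding normalizing_def by blast
    with e(2) show ?thesis by (rule bexI)
  qed
  have T_tor: "of_nat p * s = 0" if s: "s \<in> T t" for s t
  proof -
    obtain k where "k \<in> K" "s = \<rho> k - 1" using T_K[OF s] by (elim bexE)
    then show ?thesis using rho_torsion[OF K.mem_carrier] by blast
  qed
  have T_sq: "s * s' = 0" if ss: "s \<in> T t" "s' \<in> T t" for s s' t
  proof -
    obtain e f where ef: "e \<in> E" "f \<in> E" "s = c t (\<rho> e - 1)" "s' = c t (\<rho> f - 1)"
      using ss by (auto simp: T_def shift_def)
    have "s * s' = \<rho> (x [^] t) * ((\<rho> e - 1) * (\<rho> (inv (x [^] t)) * \<rho> (x [^] t)) * (\<rho> f - 1)) * \<rho> (inv (x [^] t))"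
      unfolding ef c_rho by (simp only: mult.assoc)
    also have "\<dots> = 0" using sq[OF ef(1,2)] xc by (simp add: rho_inv)
    finally show ?thesis .
  qed
  have T_norm: "\<rho> k * s * \<rho> (inv k) \<in> T t" if k: "k \<in> K" and s: "s \<in> T t" for k s t
  proof -
    let ?y = "x [^] t"
    have y: "?y \<in> carrier G" using xc by simp
    obtain e where e: "e \<in> E" "s = \<rho> (?y \<otimes> e \<otimes> inv ?y) - 1" using T_mem[OF s] by (elim bexE)
    let ?k' = "inv ?y \<otimes> k \<otimes> ?y"
    have "inv ?y \<otimes> k \<otimes> inv (inv ?y) \<in> K" using xt'[of t] k unfolding normalizing_def by blast
    then have k': "?k' \<in> K" using y by simp
    have e': "?k' \<otimes> e \<otimes> inv ?k' \<in> E" using K(3) k' e(1) unfolding normalizing_def by blast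
    have "\<rho> k * s * \<rho> (inv k) = \<rho> (k \<otimes> (?y \<otimes> e \<otimes> inv ?y) \<otimes> inv k) - 1"
      unfolding e(2) by (rule conj_shift) (use k y e in auto)
    also have "k \<otimes> (?y \<otimes> e \<otimes> inv ?y) \<otimes> inv k = ?y \<otimes> (?k' \<otimes> e \<otimes> inv ?k') \<otimes> inv ?y"
      using k y e by (simp add: m_assoc inv_mult_group inv_cancel)
    also have "\<rho> \<dots> - 1 = c t (\<rho> (?k' \<otimes> e \<otimes> inv ?k') - 1)"
      unfolding c_rho using y e' by (simp add: conj_shift)
    finally show ?thesis using e' by (auto simp: T_def shift_def)
  qed
  have T_norm': "(1 + u) * v * (1 - u) \<in> T j" if uv: "u \<in> T i" "v \<in> T j" for u v i j
  proof -
    obtain k where k: "k \<in> K" "u = \<rho> k - 1" using T_K[OF uv(1)] by (elim bexE)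
    have "\<rho> (inv k) = 1 - u"
    proof (rule rho_inv_unique)
      have "\<rho> k = 1 + u" using k by simp
      then show "\<rho> k * (1 - u) = 1" using T_sq[OF uv(1,1)] by (simp add: ring_distribs)
    qed (use k in simp)
    then show ?thesis using T_norm[OF k(1) uv(2)] k(2) by simp
  qed
  have mutual: "u * v - v * u \<in> T i \<inter> T j" "u * v * u = 0" "v * u * v = 0"
    if "u \<in> T i" "v \<in> T j" for u v i j
    by (rule mutual_normalization[OF T T p T_tor T_sq T_sq T_norm' T_norm' that]; assumption)+
  (* m represents 1/2 modulo p *)
  define m where "m = (p + 1) div 2"
  have "odd p" using p by (simp add: prime_odd_nat)
  then have m2: "m + m = p + 1" by (auto simp: m_def elim!: oddE)
  have half: "of_nat m * (y + y) = y" if "of_nat p * y = 0" for y :: 'r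
  proof -
    have "of_nat m * (y + y) = of_nat (m + m) * y" by (simp add: ring_distribs)
    then show ?thesis using that by (simp add: m2 distrib_right)
  qed
  obtain u v e where uve: "u \<in> shift E" "v \<in> shift E" "e \<in> shift E"
    and wf: "w = e + (v * a - a * v) - a * u * a"
    using limit_bi_form[OF S w] unfolding a_def .
  (* The values of s + t (a s - s a) - t^2 a s a at t = 0, 1, 2 determine the coefficients of
     t and t^2 up to the factor 2, which is absorbed by passing to halves of u and v. *)
  define u' v' where "u' = of_nat m * u" and "v' = of_nat m * v"
  have u': "u' \<in> shift E" "v' \<in> shift E"
    unfolding u'_def v'_def by (intro add_subgroup_of_nat[OF S] uve)+
  have uu: "u = u' + u'" "v = v' + v'"
    using half[OF shift_torsion[OF E.subset uve(1)]] half[OF shift_torsion[OF E.subset uve(2)]]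
    by (simp_all add: u'_def v'_def distrib_left)
  define u0 u1 u2 where "u0 = c 0 (e + u' + (v' + v' + v'))"
    and "u1 = c 1 (- (u' + u' + (v' + v' + v' + v')))" and "u2 = c 2 (u' + v')"
  have mem: "u0 \<in> T 0" "u1 \<in> T 1" "u2 \<in> T 2"
    unfolding u0_def u1_def u2_def T_def
    by (intro imageI add_subgroup_add[OF S] add_subgroup_minus[OF S] uve u')+
  have sum: "w = u0 + u1 + u2"
  proof -
    have "c 0 s = s" "c 1 s = (1 + a) * s * (1 - a)" "c 2 s = (1 + (a + a)) * s * (1 - (a + a))" for s
      by (simp_all add: c_def mult_2)
    then show ?thesis
      unfolding wf uu u0_def u1_def u2_def by (simp add: ring_distribs mult.assoc)
  qed
  have ww: "w * w = 0"
    by (rule limit_bi_mult_zero[OF a _ w[folded a_def] w[folded a_def]]) (use sq in \<open>auto simp: shift_def\<close>)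
  note sq0 = T_sq[OF mem(1,1)] T_sq[OF mem(2,2)] T_sq[OF mem(3,3)]
  note tri0 = mutual(2,3)[OF mem(1,2)] mutual(2,3)[OF mem(1,3)] mutual(2,3)[OF mem(2,3)]
  note tor0 = T_tor[OF mem(1)] T_tor[OF mem(2)] T_tor[OF mem(3)]
  have kc: "of_nat m * y = y * of_nat m" for y :: 'r by (rule mult_of_nat_commute)
  have eq: "(1 + u0) * (1 + u1) * (1 + u2) * (1 - of_nat m * (u0 * u1 - u1 * u0)) *
    (1 - of_nat m * (u0 * u2 - u2 * u0)) * (1 - of_nat m * (u1 * u2 - u2 * u1)) = 1 + w"
    unfolding sum
  proof (rule exp_three_factors[where p = p])
    show "(u0 + u1 + u2) * (u0 + u1 + u2) = 0" using ww sum by simp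
  qed (fact sq0 tri0 tor0 kc | erule half)+
  have in_G: "1 + s \<in> \<rho> ` carrier G" if s: "s \<in> T t" for s t
  proof -
    obtain k where "k \<in> K" "s = \<rho> k - 1" using T_K[OF s] by (elim bexE)
    then show ?thesis using K.mem_carrier by simp
  qed
  have in_G': "1 - of_nat m * s \<in> \<rho> ` carrier G" if "s \<in> T t" for s t
    using in_G[OF add_subgroup_minus[OF T add_subgroup_of_nat[OF T that, of m]]] by simp
  have mult_G: "y * z \<in> \<rho> ` carrier G" if "y \<in> \<rho> ` carrier G" "z \<in> \<rho> ` carrier G" for y z
    using that rho_mult by (metis (no_types, lifting) image_iff m_closed)
  have "1 + w \<in> \<rho> ` carrier G"
    unfolding eq[symmetric]
    using mutual(1)[OF mem(1,2)] mutual(1)[OF mem(1,3)] mutual(1)[OF mem(2,3)] mem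
    by (intro mult_G) (auto intro: in_G in_G')
  then show ?thesis by (metis imageE)
qed

end

section \<open>Degeneration and replacement of offenders\<close>

lemma card_le_fibres:
  assumes "finite X" "finite D" "\<And>x. x \<in> X \<Longrightarrow> f x \<in> D" "\<And>d. card {x \<in> X. f x = d} \<le> k"
  shows "card X \<le> card D * k"
proof -
  have "X = (\<Union>d\<in>D. {x \<in> X. f x = d})" using assms(3) by auto
  then have "card X \<le> (\<Sum>d\<in>D. card {x \<in> X. f x = d})"
    using card_UN_le[OF assms(2), of "\<lambda>d. {x \<in> X. f x = d}"] by simp
  also have "\<dots> \<le> card D * k" using sum_bounded_above[of D "\<lambda>d. card {x \<in> X. f x = d}" k] assms(4) by simp
  finally show ?thesis .
qed

lemma prime_dvd_two_power_diff:
  assumes "prime (p::nat)" shows "p dvd 2 ^ p - 2"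
proof -
  have p: "p \<ge> 2" using assms by (rule prime_ge_2_nat)
  have "(2::nat) ^ p = (\<Sum>k\<le>p. p choose k)" by (simp add: choose_row_sum)
  also have "{..p} = {0, p} \<union> {1..<p}" using p by auto
  also have "(\<Sum>k\<in>{0, p} \<union> {1..<p}. p choose k) = 2 + (\<Sum>k=1..<p. p choose k)"
    using p by (subst sum.union_disjoint) auto
  finally have "2 ^ p - 2 = (\<Sum>k=1..<p. p choose k)" by simp
  also have "p dvd \<dots>"
    by (rule dvd_sum) (use assms in \<open>auto intro: dvd_choose_prime\<close>)
  finally show ?thesis .
qed

context p_group_of_units
begin

text \<open>The limit of a quadratic offender is a quadratic offender: its order and its fixed points do not
  shrink. The gain is that the limit is normalized by \<open>x\<close> (the family is translated) and still by
  \<open>K\<close> (interpolation).\<close>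

lemma quad_degenerate:
  assumes E: "quad E" and K: "subgroup K G" "E \<subseteq> K" "K \<subseteq> normalizing G E"
    and x: "x \<in> normalizing G K" "(\<rho> x - 1) * (\<rho> x - 1) = 0"
  shows "\<exists>E'. quad E' \<and> K \<subseteq> normalizing G E' \<and> x \<in> normalizing G E'"
proof -
  have Esub: "subgroup E G" and E1: "E \<noteq> {\<one>}"
    and sq: "\<And>e f. e \<in> E \<Longrightarrow> f \<in> E \<Longrightarrow> (\<rho> e - 1) * (\<rho> f - 1) = 0"
    and large: "card W \<le> card E * card (fixed E)"
    using E by (auto simp: quad_def)
  interpret E: subgroup E G by (rule Esub)
  interpret K: subgroup K G by (rule K(1))
  define a where "a = \<rho> x - 1"
  have xc: "x \<in> carrier G" using x(1) by (auto simp: normalizing_def)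
  have a: "a * a = 0" using x(2) by (simp add: a_def)
  have S: "add_subgroup (shift E)" by (rule shift_subgroup[OF Esub sq])
  have finE: "finite E" by (rule finite_subset[OF E.subset fin])
  have finS: "finite (shift E)" using finE by (simp add: shift_def)
  have torS: "\<And>s. s \<in> shift E \<Longrightarrow> of_nat p * s = 0" using shift_torsion[OF E.subset] .
  define L where "L = limit_bi a (shift E)"
  have L: "add_subgroup L" unfolding L_def by (rule limit_bi_subgroup[OF S])
  have LL: "u * v = 0" if "u \<in> L" "v \<in> L" for u v
    by (rule limit_bi_mult_zero[OF a _ that[unfolded L_def]]) (use sq in \<open>auto simp: shift_def\<close>)
  define E' where "E' = {g \<in> carrier G. \<rho> g - 1 \<in> L}"
  have E'c: "E' \<subseteq> carrier G" by (auto simp: E'_def)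
  have finE': "finite E'" by (rule finite_subset[OF E'c fin])
  have "subgroup E' G"
  proof (rule subgroupI[OF E'c])
    show "E' \<noteq> {}" using add_subgroup_zero[OF L] rho_one by (auto simp: E'_def intro!: exI[of _ \<one>])
  next
    fix g assume "g \<in> E'"
    then have g: "g \<in> carrier G" "\<rho> g - 1 \<in> L" by (auto simp: E'_def)
    have "\<rho> (inv g) = 1 - (\<rho> g - 1)"
    proof (rule rho_inv_unique[OF g(1)])
      have "\<rho> g * (1 - (\<rho> g - 1)) = 1 - (\<rho> g - 1) * (\<rho> g - 1)" by (simp add: ring_distribs)
      then show "\<rho> g * (1 - (\<rho> g - 1)) = 1" using LL[OF g(2,2)] by simp
    qed
    then have "\<rho> (inv g) - 1 = - (\<rho> g - 1)" by simp
    then show "inv g \<in> E'" using g add_subgroup_minus[OF L g(2)] by (simp add: E'_def)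
  next
    fix g h assume "g \<in> E'" "h \<in> E'"
    then have g: "g \<in> carrier G" "\<rho> g - 1 \<in> L" and h: "h \<in> carrier G" "\<rho> h - 1 \<in> L" by (auto simp: E'_def)
    have "\<rho> (g \<otimes> h) - 1 = (\<rho> g - 1) * (\<rho> h - 1) + ((\<rho> g - 1) + (\<rho> h - 1))"
      using g h by (simp add: rho_mult ring_distribs)
    also have "\<dots> \<in> L" using LL[OF g(2) h(2)] add_subgroup_add[OF L g(2) h(2)] by simp
    finally show "g \<otimes> h \<in> E'" using g h by (simp add: E'_def)
  qed
  have "shift E' = L"
  proof
    show "shift E' \<subseteq> L" by (auto simp: shift_def E'_def)
    show "L \<subseteq> shift E'"
    proof
      fix w assume w: "w \<in> L"
      then obtain g where "g \<in> carrier G" "\<rho> g = 1 + w"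
        using limit_in_group[OF Esub sq K x] unfolding L_def a_def by metis
      then show "w \<in> shift E'" using w by (auto simp: shift_def E'_def intro!: image_eqI[of _ _ g])
    qed
  qed
  then have "card E' = card L" using card_shift[OF E'c] by simp
  then have cardE: "card E \<le> card E'"
    using card_limit_bi[OF S finS a] card_shift[OF E.subset] by (simp add: L_def)
  have sub_fixed: "limit_left a (fixed E) \<subseteq> fixed E'"
  proof
    fix w assume w: "w \<in> limit_left a (fixed E)"
    have "limit_left a (fixed E) \<subseteq> W"
    proof (rule limit_left_subset[OF W(1)])
      show "fixed E \<subseteq> W" by (auto simp: fixed_def)
      show "a * w \<in> W" if "w \<in> W" for w
        using add_subgroup_diff[OF W(1) W_closed[OF xc that] that] by (simp add: a_def left_diff_distrib)
    qed
    moreover have "\<rho> g * w = w" if "g \<in> E'" for g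
    proof -
      have "(\<rho> g - 1) * w = 0"
      proof (rule limit_bi_left_mult_zero[OF a _ _ w])
        show "\<rho> g - 1 \<in> limit_bi a (shift E)" using that by (simp add: E'_def L_def)
        show "s * v = 0" if "s \<in> shift E" "v \<in> fixed E" for s v
          using that by (auto simp: shift_def fixed_def left_diff_distrib)
      qed
      then show ?thesis by (simp add: left_diff_distrib)
    qed
    ultimately show "w \<in> fixed E'" using w by (auto simp: fixed_def)
  qed
  have finF: "finite (fixed F)" for F using W(2) by (auto simp: fixed_def)
  have "card (fixed E) \<le> card (limit_left a (fixed E))"
    by (rule card_limit_left[OF fixed_subgroup finF a finite_subset[OF sub_fixed finF]])
  also have "\<dots> \<le> card (fixed E')" by (rule card_mono[OF finF sub_fixed])
  finally have cardF: "card (fixed E) \<le> card (fixed E')" .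
  have "quad E'"
    unfolding quad_def
  proof (intro conjI ballI)
    show "subgroup E' G" by fact
    show "E' \<noteq> {\<one>}"
    proof
      assume "E' = {\<one>}"
      then have "card E \<le> 1" using cardE by simp
      then have "E = {\<one>}" using E.one_closed finE by (metis card_le_Suc0_iff_eq One_nat_def insert_absorb singletonD singletonI subsetI subset_antisym)
      then show False using E1 by simp
    qed
    show "(\<rho> e - 1) * (\<rho> f - 1) = 0" if "e \<in> E'" "f \<in> E'" for e f using LL that by (auto simp: E'_def)
    show "card W \<le> card E' * card (fixed E')" using large mult_le_mono[OF cardE cardF] by simp
  qed
  moreover have "k \<in> normalizing G E'" if k: "k \<in> K" for k
    unfolding normalizing_def
  proof (intro CollectI conjI ballI)
    show kc: "k \<in> carrier G" using k by simp
    fix g assume g: "g \<in> E'"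
    then have gc: "g \<in> carrier G" by (simp add: E'_def)
    have "\<rho> k * (\<rho> g - 1) * \<rho> (inv k) \<in> L"
      unfolding L_def
    proof (rule limit_bi_conj_interpolated[OF S a _ p torS])
      show "\<rho> g - 1 \<in> limit_bi a (shift E)" using g by (simp add: E'_def L_def)
      fix t :: nat and s assume "s \<in> shift E"
      then obtain e where e: "e \<in> E" "s = \<rho> e - 1" by (auto simp: shift_def)
      let ?y = "x [^] t"
      have y: "?y \<in> carrier G" using xc by simp
      interpret N: subgroup "normalizing G K" G
        by (rule subgroup_normalizing[OF finite_subset[OF K.subset fin] K.subset])
      have "?y \<in> normalizing G K" by (induction t) (auto intro: x(1))
      then have k': "?y \<otimes> k \<otimes> inv ?y \<in> K" using k unfolding normalizing_def by blast
      let ?k = "?y \<otimes> k \<otimes> inv ?y"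
      have 1: "(1 + of_nat t * a) * \<rho> k * (1 - of_nat t * a) = \<rho> ?k"
        using y kc by (simp add: rho_mult rho_power[OF xc x(2), folded a_def])
      have "inv ?k = ?y \<otimes> inv k \<otimes> inv ?y" using y kc by (simp add: inv_mult_group m_assoc)
      then have 2: "(1 + of_nat t * a) * \<rho> (inv k) * (1 - of_nat t * a) = \<rho> (inv ?k)"
        using y kc by (simp add: rho_mult rho_power[OF xc x(2), folded a_def])
      have "\<rho> ?k * s * \<rho> (inv ?k) = \<rho> (?k \<otimes> e \<otimes> inv ?k) - 1"
        unfolding e(2) by (rule conj_shift) (use e k' in auto)
      moreover have "?k \<otimes> e \<otimes> inv ?k \<in> E" using K(3) k' e(1) unfolding normalizing_def by blast
      ultimately show "(1 + of_nat t * a) * \<rho> k * (1 - of_nat t * a) * s *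
         ((1 + of_nat t * a) * \<rho> (inv k) * (1 - of_nat t * a)) \<in> shift E"
        unfolding 1 2 by (simp add: shift_def)
    qed
    then show "k \<otimes> g \<otimes> inv k \<in> E'" using kc gc by (simp add: conj_shift E'_def)
  qed
  moreover have "x \<in> normalizing G E'"
    unfolding normalizing_def
  proof (intro CollectI conjI ballI xc)
    fix g assume g: "g \<in> E'"
    then have gc: "g \<in> carrier G" by (simp add: E'_def)
    have "\<rho> x * (\<rho> g - 1) * \<rho> (inv x) = (1 + a) * (\<rho> g - 1) * (1 - a)"
      using rho_power[OF xc x(2), of 1] xc by (simp add: a_def)
    also have "\<dots> \<in> L" unfolding L_def
      by (rule limit_bi_conj[OF S a _ p torS]) (use g in \<open>auto simp: E'_def L_def\<close>)
    finally show "x \<otimes> g \<otimes> inv x \<in> E'" using xc gc by (simp add: conj_shift E'_def)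
  qed
  ultimately show ?thesis by blast
qed

text \<open>Choose \<open>E\<close> such that the group \<open>N E\<close>, generated by the quadratic elements that normalize \<open>E\<close>, is as
  large as possible. If a quadratic element lies outside \<open>N E\<close>, then some such element
  normalizes \<open>N E\<close>, and the limit of \<open>E\<close> along it contradicts maximality.\<close>

lemma quad_normalized_by_quadratic_elements:
  assumes "quad E0"
  shows "\<exists>E. quad E \<and> {g \<in> carrier G. (\<rho> g - 1) * (\<rho> g - 1) = 0} \<subseteq> normalizing G E"
proof -
  define Q where "Q = {g \<in> carrier G. (\<rho> g - 1) * (\<rho> g - 1) = 0}"
  define N where "N E = generate G (Q \<inter> normalizing G E)" for E
  have Qc: "Q \<subseteq> carrier G" by (auto simp: Q_def)
  have Nsub: "subgroup (N E) G" for E unfolding N_def by (rule generate_is_subgroup) (use Qc in auto)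
  have Nc: "N E \<subseteq> carrier G" for E by (rule subgroup.subset[OF Nsub])
  have bound: "card (N E) \<le> card (carrier G)" for E by (rule card_mono[OF fin Nc])
  have "\<exists>E. quad E \<and> (\<forall>E'. quad E' \<longrightarrow> card (N E') \<le> card (N E))"
    using ex_has_greatest_nat[of quad E0 "\<lambda>E. card (N E)" "Suc (card (carrier G))"] assms bound
    by (metis le_imp_less_Suc)
  then obtain E where E: "quad E" and max: "\<And>E'. quad E' \<Longrightarrow> card (N E') \<le> card (N E)" by blast
  interpret E: subgroup E G using E by (simp add: quad_def)
  have finE: "finite E" by (rule finite_subset[OF E.subset fin])
  have NE: "N E \<subseteq> normalizing G E"
    unfolding N_def by (rule generate_subgroup_incl[OF _ subgroup_normalizing[OF finE E.subset]]) simp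
  have "Q \<subseteq> N E"
  proof (rule ccontr)
    assume nQ: "\<not> Q \<subseteq> N E"
    have "Q \<inter> normalizing G E \<subseteq> Q \<inter> N E" unfolding N_def by (auto intro: generate.incl)
    then have "N E \<subseteq> generate G (Q \<inter> N E)" unfolding N_def by (rule mono_generate)
    moreover have "generate G (Q \<inter> N E) \<subseteq> N E" by (rule generate_subgroup_incl[OF _ Nsub]) simp
    ultimately have gen: "N E = generate G (Q \<inter> N E)" by simp
    have Qconj: "g \<otimes> x \<otimes> inv g \<in> Q" if "g \<in> carrier G" "x \<in> Q" for g x
    proof -
      have x: "x \<in> carrier G" "(\<rho> x - 1) * (\<rho> x - 1) = 0" using that by (auto simp: Q_def)
      have "(\<rho> g * (\<rho> x - 1) * \<rho> (inv g)) * (\<rho> g * (\<rho> x - 1) * \<rho> (inv g))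
        = \<rho> g * ((\<rho> x - 1) * (\<rho> (inv g) * \<rho> g) * (\<rho> x - 1)) * \<rho> (inv g)"
        by (simp only: mult.assoc)
      also have "\<dots> = 0" using x that(1) by (simp add: rho_inv)
      finally show ?thesis using x that(1) by (simp add: conj_shift Q_def)
    qed
    obtain x where x: "x \<in> Q" "x \<notin> N E" "x \<in> normalizing G (N E)"
      using exists_normalizing_generator[OF p(1) order_G fin Nsub Qc Qconj gen nQ] by blast
    have "E \<subseteq> Q \<inter> normalizing G E"
      using E E.subset by (auto simp: quad_def Q_def normalizing_def)
    then have "E \<subseteq> N E" unfolding N_def by (auto intro: generate.incl)
    then obtain E' where E': "quad E'" "N E \<subseteq> normalizing G E'" "x \<in> normalizing G E'"
      using quad_degenerate[OF E Nsub _ NE x(3)] x(1) by (auto simp: Q_def)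
    have "N E \<subseteq> N E'"
    proof -
      have "Q \<inter> N E \<subseteq> Q \<inter> normalizing G E'" using E'(2) by blast
      then show ?thesis by (subst gen) (simp add: N_def mono_generate)
    qed
    moreover have "x \<in> N E'" unfolding N_def using x(1) E'(3) by (auto intro: generate.incl)
    ultimately have "N E \<subset> N E'" using x(2) by blast
    then have "card (N E) < card (N E')" by (rule psubset_card_mono[OF finite_subset[OF Nc fin]])
    then show False using max[OF E'(1)] by simp
  qed
  then show ?thesis using E NE Q_def by blast
qed

text \<open>Timmesfeld's replacement argument. Let \<open>A\<close> be an offender of least order. For a vector \<open>v\<close>, the
  centralizer \<open>B v\<close> of \<open>[v, A]\<close> in \<open>A\<close> satisfies the offender inequality as well: if two elements
  of \<open>A\<close> move \<open>v\<close> equally modulo the fixed points of \<open>A\<close>, then they differ by an element of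
  \<open>B v\<close>. By minimality \<open>B v\<close> is trivial or all of \<open>A\<close>. If it were trivial, then every vector,
  and in particular \<open>v\<close> itself, would have the form \<open>(a - 1) v + c\<close> with \<open>c\<close> fixed. Then
  \<open>a\<close> doubles \<open>(b - 1) v\<close> for every \<open>b\<close>; since \<open>a\<close> has order dividing \<open>p\<close> and
  \<open>2 ^ p\<close> is 2 modulo \<open>p\<close>, this forces \<open>(b - 1) v = 0\<close>, so all vectors are fixed and
  \<open>B v = A\<close> after all. And \<open>B v = A\<close> for all \<open>v\<close> is quadratic action.\<close>

lemma quad_replacement:
  assumes A0: "subgroup A0 G" "A0 \<noteq> {\<one>}" "\<And>a b. a \<in> A0 \<Longrightarrow> b \<in> A0 \<Longrightarrow> a \<otimes> b = b \<otimes> a"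
    "\<And>a. a \<in> A0 \<Longrightarrow> a [^] p = \<one>" "card W \<le> card A0 * card (fixed A0)"
  shows "\<exists>E. quad E"
proof -
  define off where "off A \<longleftrightarrow> subgroup A G \<and> A \<noteq> {\<one>} \<and> (\<forall>a\<in>A. \<forall>b\<in>A. a \<otimes> b = b \<otimes> a) \<and>
    (\<forall>a\<in>A. a [^] p = \<one>) \<and> card W \<le> card A * card (fixed A)" for A
  have "off A0" using A0 by (simp add: off_def)
  then obtain A where A: "off A" and min: "\<And>B. off B \<Longrightarrow> card A \<le> card B"
    using ex_has_least_nat[of off A0 card] by blast
  have Asub: "subgroup A G" and A1: "A \<noteq> {\<one>}" and comm: "\<And>a b. a \<in> A \<Longrightarrow> b \<in> A \<Longrightarrow> a \<otimes> b = b \<otimes> a"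
    and expo: "\<And>a. a \<in> A \<Longrightarrow> a [^] p = \<one>" and large: "card W \<le> card A * card (fixed A)"
    using A by (auto simp: off_def)
  interpret A: subgroup A G by (rule Asub)
  have finA: "finite A" by (rule finite_subset[OF A.subset fin])
  have finF: "finite (fixed F)" for F using W(2) by (auto simp: fixed_def)
  have comm': "(\<rho> a - 1) * ((\<rho> b - 1) * w) = (\<rho> b - 1) * ((\<rho> a - 1) * w)" if "a \<in> A" "b \<in> A" for a b w
  proof -
    have "\<rho> a * \<rho> b = \<rho> b * \<rho> a" using comm[OF that] that rho_mult by (metis A.mem_carrier)
    then have "(\<rho> a - 1) * (\<rho> b - 1) = (\<rho> b - 1) * (\<rho> a - 1)" by (simp add: ring_distribs)
    then show ?thesis by (simp flip: mult.assoc)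
  qed
  define B where "B v = {a \<in> A. \<forall>c\<in>A. (\<rho> a - 1) * ((\<rho> c - 1) * v) = 0}" for v
  have rho_fix: "(\<rho> a - 1) * w = 0 \<longleftrightarrow> \<rho> a * w = w" for a w by (simp add: left_diff_distrib)
  have B_alt: "B v = {a \<in> A. \<forall>c\<in>A. \<rho> a * ((\<rho> c - 1) * v) = (\<rho> c - 1) * v}" for v
    unfolding B_def rho_fix ..
  have Bsub: "subgroup (B v) G" for v
  proof (rule subgroupI)
    show "B v \<subseteq> carrier G" by (auto simp: B_def)
    have "\<one> \<in> B v" using A.one_closed rho_one by (simp add: B_alt)
    then show "B v \<noteq> {}" by blast
    show "inv a \<in> B v" if "a \<in> B v" for a
    proof -
      have a: "a \<in> A" "\<And>c. c \<in> A \<Longrightarrow> \<rho> a * ((\<rho> c - 1) * v) = (\<rho> c - 1) * v" using that by (auto simp: B_alt)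
      have "\<rho> (inv a) * ((\<rho> c - 1) * v) = (\<rho> c - 1) * v" if "c \<in> A" for c
        by (subst a(2)[OF that, symmetric]) (use rho_inv(2)[of a] a(1) in \<open>simp flip: mult.assoc\<close>)
      then show ?thesis using a(1) by (simp add: B_alt)
    qed
    show "a \<otimes> b \<in> B v" if "a \<in> B v" "b \<in> B v" for a b
      using that by (auto simp: B_alt rho_mult mult.assoc)
  qed
  define C where "C = fixed A"
  have Csub: "add_subgroup C" unfolding C_def by (rule fixed_subgroup)
  have cW: "(\<rho> a - 1) * w \<in> W" if "a \<in> A" "w \<in> W" for a w
    using add_subgroup_diff[OF W(1) W_closed[OF _ that(2)] that(2)] that(1) by (simp add: left_diff_distrib)
  (* Counting the fibres and the image of this map bounds card A * card C. *)
  define \<theta> where "\<theta> v = (\<lambda>(a, c). (\<rho> a - 1) * v + c)" for v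
  have \<theta>_fixed: "\<theta> v y \<in> fixed (B v)" if v: "v \<in> W" and y: "y \<in> A \<times> C" for v y
  proof -
    obtain a c where y': "y = (a, c)" "a \<in> A" "c \<in> C" using y by auto
    have "(\<rho> a - 1) * v \<in> fixed (B v)" using cW[OF y'(2) v] y'(2) by (auto simp: fixed_def B_alt)
    moreover have "c \<in> fixed (B v)" using y'(3) by (auto simp: C_def fixed_def B_def)
    ultimately show ?thesis using add_subgroup_add[OF fixed_subgroup] by (simp add: \<theta>_def y')
  qed
  have fibre: "card {y \<in> A \<times> C. \<theta> v y = d} \<le> card (B v)" for v d
  proof (cases "{y \<in> A \<times> C. \<theta> v y = d} = {}")
    case False
    then obtain a0 c0 where a0: "a0 \<in> A" "c0 \<in> C" "\<theta> v (a0, c0) = d" by auto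
    let ?h = "\<lambda>y. inv a0 \<otimes> fst y"
    show ?thesis
    proof (rule card_inj_on_le[where f = ?h])
      show "finite (B v)" using finA by (simp add: B_def)
      show "?h ` {y \<in> A \<times> C. \<theta> v y = d} \<subseteq> B v"
      proof
        fix b assume "b \<in> ?h ` {y \<in> A \<times> C. \<theta> v y = d}"
        then obtain a c where a: "a \<in> A" "c \<in> C" "\<theta> v (a, c) = d" "b = inv a0 \<otimes> a" by auto
        have "(\<rho> a - 1) * v + c = (\<rho> a0 - 1) * v + c0" using a(3) a0(3) by (simp add: \<theta>_def)
        then have "(\<rho> a - \<rho> a0) * v = c0 - c" by (simp add: left_diff_distrib algebra_simps)
        then have in_C: "(\<rho> a - \<rho> a0) * v \<in> C" using add_subgroup_diff[OF Csub a0(2) a(2)] by simp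
        have "(\<rho> b - 1) * ((\<rho> e - 1) * v) = 0" if e: "e \<in> A" for e
        proof -
          have "(\<rho> e - 1) * ((\<rho> a - \<rho> a0) * v) = 0"
            using in_C e by (auto simp: C_def fixed_def left_diff_distrib)
          moreover have "(\<rho> a - \<rho> a0) * ((\<rho> e - 1) * v) = (\<rho> e - 1) * ((\<rho> a - \<rho> a0) * v)"
            using comm'[OF a(1) e, of v] comm'[OF a0(1) e, of v] by (simp add: ring_distribs)
          ultimately have 0: "(\<rho> a - \<rho> a0) * ((\<rho> e - 1) * v) = 0" by simp
          have "\<rho> b - 1 = \<rho> (inv a0) * (\<rho> a - \<rho> a0)"
            using a a0 rho_inv(2)[of a0] by (simp add: rho_mult right_diff_distrib)
          then show ?thesis using 0 by (simp add: mult.assoc)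
        qed
        then show "b \<in> B v" using a a0 by (simp add: B_def)
      qed
      show "inj_on ?h {y \<in> A \<times> C. \<theta> v y = d}"
      proof (rule inj_onI)
        fix y z assume "y \<in> {y \<in> A \<times> C. \<theta> v y = d}" "z \<in> {y \<in> A \<times> C. \<theta> v y = d}"
          and eq: "inv a0 \<otimes> fst y = inv a0 \<otimes> fst z"
        then obtain a c b e where yz: "y = (a, c)" "z = (b, e)" "a \<in> A" "b \<in> A" "\<theta> v (a, c) = \<theta> v (b, e)"
          by (cases y; cases z) auto
        have "a = b" using eq yz a0(1) by simp
        then show "y = z" using yz by (simp add: \<theta>_def)
      qed
    qed
  qed (simp only: card.empty zero_le)
  have count: "card A * card C \<le> card (B v) * card (fixed (B v))" if v: "v \<in> W" for v
  proof -
    have "card (A \<times> C) \<le> card (fixed (B v)) * card (B v)"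
      by (rule card_le_fibres[OF _ finF \<theta>_fixed[OF v] fibre]) (use finA finF in \<open>auto simp: C_def\<close>)
    then show ?thesis by (simp add: card_cartesian_product mult.commute)
  qed
  have BA: "B v = A" if v: "v \<in> W" for v
  proof (cases "B v = {\<one>}")
    case False
    then have "off (B v)"
      using Bsub[of v] count[OF v] large comm expo by (auto simp: off_def B_def C_def)
    then have "card A \<le> card (B v)" by (rule min)
    then show ?thesis using card_seteq[OF finA, of "B v"] by (auto simp: B_def)
  next
    case True
    have inj: "inj_on (\<theta> v) (A \<times> C)"
    proof (rule inj_onI)
      fix y z assume yz: "y \<in> A \<times> C" "z \<in> A \<times> C" "\<theta> v y = \<theta> v z"
      have "card {x \<in> A \<times> C. \<theta> v x = \<theta> v z} \<le> 1" using fibre[of v "\<theta> v z"] True by simp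
      moreover have "finite {x \<in> A \<times> C. \<theta> v x = \<theta> v z}" using finA finF by (simp add: C_def)
      ultimately show "y = z" using yz by (auto simp: card_le_Suc0_iff_eq)
    qed
    have img: "\<theta> v ` (A \<times> C) \<subseteq> W" using \<theta>_fixed[OF v] by (auto simp: fixed_def)
    have "card W \<le> card (\<theta> v ` (A \<times> C))"
      using large card_image[OF inj] by (simp add: C_def card_cartesian_product)
    then have "\<theta> v ` (A \<times> C) = W" by (rule card_seteq[OF W(2) img])
    then obtain a c where ac: "a \<in> A" "c \<in> C" "v = (\<rho> a - 1) * v + c"
      using v by (auto simp: \<theta>_def)
    have zero: "(\<rho> b - 1) * v = 0" if b: "b \<in> A" for b
    proof -
      define y where "y = (\<rho> b - 1) * v"
      have "(\<rho> b - 1) * c = 0" using ac(2) b by (auto simp: C_def fixed_def left_diff_distrib)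
      then have "y = (\<rho> b - 1) * ((\<rho> a - 1) * v)"
        unfolding y_def by (subst ac(3)) (simp add: distrib_left)
      then have "y = (\<rho> a - 1) * y" using comm'[OF b ac(1), of v] by (simp add: y_def)
      then have "\<rho> a * y = y + y" by (simp add: left_diff_distrib algebra_simps)
      then have dbl: "\<rho> a * y = of_nat 2 * y" by (simp add: mult_2)
      have pow: "\<rho> (a [^] k) * y = of_nat (2 ^ k) * y" for k :: nat
      proof (induction k)
        case (Suc k)
        have "\<rho> (a [^] Suc k) * y = \<rho> (a [^] k) * (\<rho> a * y)"
          using ac(1) by (simp add: rho_mult mult.assoc)
        also have "\<dots> = (\<rho> (a [^] k) * of_nat 2) * y" unfolding dbl by (simp only: mult.assoc)
        also have "\<dots> = of_nat 2 * (\<rho> (a [^] k) * y)" 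
          by (simp only: mult_of_nat_commute[symmetric] mult.assoc)
        also have "\<dots> = of_nat (2 ^ Suc k) * y" unfolding Suc by (simp only: power_Suc of_nat_mult mult.assoc)
        finally show ?case .
      qed (simp add: rho_one)
      have "y = of_nat (2 ^ p) * y" using pow[of p] expo[OF ac(1)] rho_one by simp
      also have "(2::nat) ^ p = (2 ^ p - 2) + 2"
        using power_increasing[of 1 p "2::nat"] p(2) by simp
      also have "of_nat ((2 ^ p - 2) + 2) * y = of_nat (2 ^ p - 2) * y + y + y"
        by (simp only: of_nat_add distrib_right of_nat_numeral mult_2 add.assoc)
      also have "of_nat (2 ^ p - 2) * y = 0"
      proof -
        obtain q where "2 ^ p - 2 = p * q" using prime_dvd_two_power_diff[OF p(1)] by (elim dvdE)
        then have "(2 ^ p - 2 :: nat) = q * p" by (simp add: mult.commute)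
        moreover have "of_nat p * y = 0"
          unfolding y_def by (intro torsion_mult rho_torsion) (use b in simp)
        ultimately show ?thesis by (simp only: of_nat_mult mult.assoc mult_zero_right)
      qed
      finally show "(\<rho> b - 1) * v = 0" by (simp add: y_def)
    qed
    have "W \<subseteq> C"
    proof
      fix w assume "w \<in> W"
      then obtain b c where "b \<in> A" "c \<in> C" "w = (\<rho> b - 1) * v + c"
        using \<open>\<theta> v ` (A \<times> C) = W\<close> by (auto simp: \<theta>_def)
      then show "w \<in> C" using zero by simp
    qed
    then show ?thesis using v by (auto simp: B_def C_def fixed_def left_diff_distrib)
  qed
  have quadratic: "(\<rho> a - 1) * (\<rho> c - 1) = 0" if ac: "a \<in> A" "c \<in> A" for a c
  proof (rule W_faithful)
    fix w assume "w \<in> W"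
    then have "a \<in> B w" using BA ac(1) by simp
    then show "(\<rho> a - 1) * ((\<rho> c - 1) * w) = 0" using ac(2) by (simp add: B_def)
  qed (use ac in simp_all)
  have "quad A" unfolding quad_def by (intro conjI ballI quadratic Asub A1 large)
  then show ?thesis by blast
qed

end

section \<open>Abelian groups inside a ring\<close>

text \<open>The product of all abelian groups whose elements form a subset of \<open>'v\<close>. It is an abelian group on
  a whole type, and every abelian group with elements in \<open>'v\<close> is a direct summand, so endomorphisms
  of the latter extend by the identity on the other factors. In this way a group given by a carrier
  set is brought into the realm of type classes.\<close>

typedef 'v ab_product = "{f :: 'v monoid \<Rightarrow> 'v. \<forall>M. if comm_group M then f M \<in> carrier M else f M = undefined}"
proof
  show "(\<lambda>M. if comm_group M then \<one>\<^bsub>M\<^esub> else undefined) \<in>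
    {f :: 'v monoid \<Rightarrow> 'v. \<forall>M. if comm_group M then f M \<in> carrier M else f M = undefined}"
    by (auto intro: monoid.one_closed group.is_monoid comm_group.axioms)
qed

setup_lifting type_definition_ab_product

lemma comm_group_facts:
  fixes M :: "('v, 'm) monoid_scheme"
  assumes "comm_group M"
  shows "group M" "monoid M"
  using assms by (auto intro: group.is_monoid comm_group.axioms)

instantiation ab_product :: (type) ab_group_add
begin

lift_definition zero_ab_product :: "'v ab_product"
  is "\<lambda>M. if comm_group M then \<one>\<^bsub>M\<^esub> else undefined"
  by (auto intro: monoid.one_closed comm_group_facts)

lift_definition plus_ab_product :: "'v ab_product \<Rightarrow> 'v ab_product \<Rightarrow> 'v ab_product"
  is "\<lambda>f g M. if comm_group M then f M \<otimes>\<^bsub>M\<^esub> g M else undefined"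
  by (auto split: if_splits intro: monoid.m_closed comm_group_facts)

lift_definition uminus_ab_product :: "'v ab_product \<Rightarrow> 'v ab_product"
  is "\<lambda>f M. if comm_group M then inv\<^bsub>M\<^esub> f M else undefined"
  by (auto split: if_splits intro: group.inv_closed comm_group_facts)

lift_definition minus_ab_product :: "'v ab_product \<Rightarrow> 'v ab_product \<Rightarrow> 'v ab_product"
  is "\<lambda>f g M. if comm_group M then f M \<otimes>\<^bsub>M\<^esub> inv\<^bsub>M\<^esub> g M else undefined"
  by (auto simp: comm_group_facts monoid.m_closed group.inv_closed)

instance
proof
  fix a b c :: "'v ab_product"
  show "a + b + c = a + (b + c)"
    by transfer (auto simp: fun_eq_iff split: if_splits intro: monoid.m_assoc comm_group_facts)
  show "a + b = b + a"
    by transfer (auto simp: fun_eq_iff split: if_splits intro: comm_monoid.m_comm comm_group.axioms)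
  show "0 + a = a"
    by transfer (auto simp: fun_eq_iff split: if_splits intro: monoid.l_one comm_group_facts)
  show "- a + a = 0"
    by transfer (auto simp: fun_eq_iff split: if_splits intro: group.l_inv comm_group_facts)
  show "a - b = a + - b"
    by transfer (auto simp: fun_eq_iff)
qed

end

lift_definition summand :: "'v monoid \<Rightarrow> 'v \<Rightarrow> 'v ab_product"
  is "\<lambda>M v N. if comm_group N then if N = M \<and> v \<in> carrier M then v else \<one>\<^bsub>N\<^esub> else undefined"
  by (auto intro: monoid.one_closed comm_group_facts)

lift_definition component :: "'v monoid \<Rightarrow> 'v ab_product \<Rightarrow> 'v" is "\<lambda>M f. f M" .

text \<open>Outside the intended case the identity is used, which keeps the operation total and additive.\<close>

lift_definition on_summand :: "'v monoid \<Rightarrow> ('v \<Rightarrow> 'v) \<Rightarrow> 'v ab_product \<Rightarrow> 'v ab_product"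
  is "\<lambda>M h f N. if N = M \<and> comm_group M \<and> h \<in> hom M M then h (f M) else f N"
  by (auto simp: hom_def Pi_iff split: if_splits)

lemma component_closed: "comm_group M \<Longrightarrow> component M f \<in> carrier M"
  by transfer (auto split: if_splits)

lemma component_summand: "comm_group M \<Longrightarrow> v \<in> carrier M \<Longrightarrow> component M (summand M v) = v"
  by transfer auto

lemma summand_mult:
  assumes "comm_group M" "v \<in> carrier M" "w \<in> carrier M"
  shows "summand M (v \<otimes>\<^bsub>M\<^esub> w) = summand M v + summand M w"
  using assms by transfer (auto simp: fun_eq_iff comm_group_facts monoid.m_closed monoid.l_one monoid.one_closed)

lemma summand_one: "comm_group M \<Longrightarrow> summand M \<one>\<^bsub>M\<^esub> = 0"
  by transfer (auto simp: fun_eq_iff)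

lemma on_summand_add: "on_summand M h (f + g) = on_summand M h f + on_summand M h g"
  by transfer (auto simp: fun_eq_iff hom_def split: if_splits)

lemma on_summand_summand:
  assumes "comm_group M" "h \<in> hom M M" "v \<in> carrier M"
  shows "on_summand M h (summand M v) = summand M (h v)"
  using assms by transfer (auto simp: fun_eq_iff hom_def)

lemma on_summand_diff:
  assumes "comm_group M" "h \<in> hom M M"
  shows "on_summand M h f - f = summand M (h (component M f) \<otimes>\<^bsub>M\<^esub> inv\<^bsub>M\<^esub> (component M f))"
  using assms
  by transfer (auto simp: fun_eq_iff hom_def Pi_iff comm_group_facts monoid.m_closed group.inv_closed group.r_inv)

lemma on_summand_comp:
  assumes "comm_group M" "h \<in> hom M M" "k \<in> hom M M" "l \<in> hom M M" "\<And>v. v \<in> carrier M \<Longrightarrow> l v = h (k v)"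
  shows "on_summand M l f = on_summand M h (on_summand M k f)"
  using assms by transfer (auto simp: fun_eq_iff hom_def)

lemma on_summand_id:
  assumes "comm_group M" "h \<in> hom M M" "\<And>v. v \<in> carrier M \<Longrightarrow> h v = v"
  shows "on_summand M h f = f"
  using assms by transfer (auto simp: fun_eq_iff)

lifting_forget ab_product.lifting

text \<open>Endomorphisms of \<open>\<int> \<times> \<Prod> M\<close>. The factor \<open>\<int>\<close> lets vectors be ring elements too: a vector \<open>v\<close> of
  a summand becomes the endomorphism \<open>vec M v\<close> that sends the generator of \<open>\<int>\<close> to \<open>v\<close>, and
  applying an automorphism to \<open>v\<close> becomes multiplication from the left. It also makes \<open>0 \<noteq> 1\<close>.\<close>

typedef 'v ab_end = "{f :: int \<times> 'v ab_product \<Rightarrow> int \<times> 'v ab_product. \<forall>x y. f (x + y) = f x + f y}"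
  by (rule exI[of _ id]) simp

setup_lifting type_definition_ab_end

instantiation ab_end :: (type) ring_1
begin

lift_definition zero_ab_end :: "'v ab_end" is "\<lambda>_. 0" by simp
lift_definition one_ab_end :: "'v ab_end" is "\<lambda>x. x" by simp
lift_definition plus_ab_end :: "'v ab_end \<Rightarrow> 'v ab_end \<Rightarrow> 'v ab_end" is "\<lambda>f g x. f x + g x" by simp
lift_definition minus_ab_end :: "'v ab_end \<Rightarrow> 'v ab_end \<Rightarrow> 'v ab_end" is "\<lambda>f g x. f x - g x" by simp
lift_definition uminus_ab_end :: "'v ab_end \<Rightarrow> 'v ab_end" is "\<lambda>f x. - f x" by simp
lift_definition times_ab_end :: "'v ab_end \<Rightarrow> 'v ab_end \<Rightarrow> 'v ab_end" is "\<lambda>f g x. f (g x)" by simp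

instance
proof
  fix a b c :: "'v ab_end"
  show "a + b + c = a + (b + c)" by transfer (simp add: add.assoc)
  show "a + b = b + a" by transfer (simp add: add.commute)
  show "0 + a = a" by transfer simp
  show "- a + a = 0" by transfer simp
  show "a - b = a + - b" by transfer simp
  show "a * b * c = a * (b * c)" by transfer simp
  show "1 * a = a" by transfer simp
  show "a * 1 = a" by transfer simp
  show "(a + b) * c = a * c + b * c" by transfer simp
  show "a * (b + c) = a * b + a * c" by transfer (simp del: split_paired_All)
  show "(0 :: 'v ab_end) \<noteq> 1"
    by transfer (auto simp: fun_eq_iff zero_prod_def intro!: exI[of _ 1])
qed

end

lift_definition app :: "'v ab_end \<Rightarrow> int \<times> 'v ab_product \<Rightarrow> int \<times> 'v ab_product" is "\<lambda>f. f" .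

lemma app_simps:
  "app 0 x = 0" "app 1 x = x" "app (f + g) x = app f x + app g x" "app (f - g) x = app f x - app g x"
  "app (f * g) x = app f (app g x)"
  by (transfer; simp)+

lemma app_ext: "(\<And>x. app f x = app g x) \<Longrightarrow> f = g"
  by transfer (auto simp: fun_eq_iff)

lift_definition end_of :: "'v monoid \<Rightarrow> ('v \<Rightarrow> 'v) \<Rightarrow> 'v ab_end"
  is "\<lambda>M h (k, f). (k, on_summand M h f)"
  by (auto simp: on_summand_add)

lift_definition vec :: "'v monoid \<Rightarrow> 'v \<Rightarrow> 'v ab_end"
  is "\<lambda>M v (k, f). (0, if comm_group M \<and> v \<in> carrier M then summand M (v [^]\<^bsub>M\<^esub> k) else 0)"
  by (auto simp: summand_mult[symmetric] group.int_pow_mult group.int_pow_closed comm_group_facts)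

lemma app_end_of: "app (end_of M h) (k, f) = (k, on_summand M h f)"
  by transfer simp

lemma app_vec: "comm_group M \<Longrightarrow> v \<in> carrier M \<Longrightarrow> app (vec M v) (k, f) = (0, summand M (v [^]\<^bsub>M\<^esub> (k::int)))"
  by transfer simp

lemma app_end_of_diff:
  assumes "comm_group M" "h \<in> hom M M"
  shows "app (end_of M h - 1) (k, f) =
    (0, summand M (h (component M f) \<otimes>\<^bsub>M\<^esub> inv\<^bsub>M\<^esub> (component M f)))"
  by (simp add: app_simps app_end_of on_summand_diff[OF assms])

lemma vec_diff:
  assumes "comm_group M" "v \<in> carrier M" "w \<in> carrier M"
  shows "vec M v - vec M w = vec M (v \<otimes>\<^bsub>M\<^esub> inv\<^bsub>M\<^esub> w)"
proof (rule app_ext)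
  interpret comm_group M by fact
  fix x :: "int \<times> 'a ab_product"
  obtain k f where x: "x = (k, f)" by (cases x)
  have c: "w [^]\<^bsub>M\<^esub> k \<in> carrier M" "v [^]\<^bsub>M\<^esub> k \<in> carrier M" using assms by simp_all
  have "(v \<otimes>\<^bsub>M\<^esub> inv\<^bsub>M\<^esub> w) [^]\<^bsub>M\<^esub> k = v [^]\<^bsub>M\<^esub> k \<otimes>\<^bsub>M\<^esub> inv\<^bsub>M\<^esub> (w [^]\<^bsub>M\<^esub> k)"
    using assms by (simp add: int_pow_distrib int_pow_inv)
  moreover have "summand M (inv\<^bsub>M\<^esub> (w [^]\<^bsub>M\<^esub> k)) = - summand M (w [^]\<^bsub>M\<^esub> k)"
    using summand_mult[OF assms(1) c(1), of "inv\<^bsub>M\<^esub> (w [^]\<^bsub>M\<^esub> k)"] c summand_one[OF assms(1)]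
    by (simp add: eq_neg_iff_add_eq_0 add.commute)
  ultimately show "app (vec M v - vec M w) x = app (vec M (v \<otimes>\<^bsub>M\<^esub> inv\<^bsub>M\<^esub> w)) x"
    using assms c by (simp add: x app_simps app_vec summand_mult)
qed

lemma inj_vec:
  assumes "comm_group M"
  shows "inj_on (vec M) (carrier M)"
proof (rule inj_onI)
  interpret comm_group M by fact
  fix v w assume vw: "v \<in> carrier M" "w \<in> carrier M" "vec M v = vec M w"
  have "app (vec M v) (1, 0) = app (vec M w) (1, 0)" by (simp only: vw(3))
  then have "summand M v = summand M w" by (simp add: app_vec assms vw(1,2))
  then show "v = w" using component_summand[OF assms] vw by metis
qed

lemma end_of_vec:
  assumes "comm_group M" "h \<in> hom M M" "v \<in> carrier M"
  shows "end_of M h * vec M v = vec M (h v)"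
proof (rule app_ext)
  interpret comm_group M by fact
  fix x :: "int \<times> 'a ab_product"
  obtain k f where x: "x = (k, f)" by (cases x)
  interpret h: group_hom M M h using assms(2) by unfold_locales
  show "app (end_of M h * vec M v) x = app (vec M (h v)) x"
    using assms by (simp add: x app_simps app_vec app_end_of on_summand_summand h.hom_int_pow)
qed

section \<open>Faithful actions as groups of units\<close>

lemma app_of_nat_mult_summand:
  assumes "comm_group M" "u \<in> carrier M" "app x y = (0, summand M u)"
  shows "app (of_nat n * x) y = (0, summand M (u [^]\<^bsub>M\<^esub> n))"
proof -
  interpret comm_group M by fact
  show ?thesis
    using assms
    by (induction n) (simp_all add: app_simps distrib_right summand_mult summand_one zero_prod_def add.commute)
qed

text \<open>Forgets additional record fields, since the factors of the product are indexed by plain monoids.\<close>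

definition base_monoid :: "('v, 'n) monoid_scheme \<Rightarrow> 'v monoid" where
  "base_monoid V = \<lparr>carrier = carrier V, mult = mult V, one = one V\<rparr>"

lemma base_monoid_simps [simp]:
  "carrier (base_monoid V) = carrier V" "mult (base_monoid V) = mult V" "one (base_monoid V) = one V"
  "m_inv (base_monoid V) = m_inv V"
  by (simp_all add: base_monoid_def m_inv_def fun_eq_iff)

lemma base_monoid_pow [simp]: "x [^]\<^bsub>base_monoid V\<^esub> (n::nat) = x [^]\<^bsub>V\<^esub> n"
  by (simp add: nat_pow_def)

lemma comm_group_base_monoid:
  assumes "comm_group V" shows "comm_group (base_monoid V)"
proof -
  interpret comm_group V by fact
  show ?thesis
    by (rule comm_groupI) (auto simp: m_assoc intro: m_comm l_inv_ex)
qed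

text \<open>For \<open>g\<close> in the group, \<open>\<rho> g - 1\<close> takes all its values in the summand \<open>V\<close> and depends only on the
  component in \<open>V\<close>. So identities between such elements can be checked on vectors of \<open>V\<close>.\<close>

lemma p_group_of_units_of_action:
  fixes V :: "('v, 'n) monoid_scheme"
  assumes p: "prime p" "p \<ge> 5" and G: "finite_p_group p G" and V: "elementary_abelian p V"
    and act: "acts_faithfully G V \<phi>"
  obtains n where "p_group_of_units G (\<lambda>g. end_of (base_monoid V) (\<phi> g)) p n
    (vec (base_monoid V) ` carrier V)"
proof -
  define M where "M = base_monoid V"
  define \<rho> where "\<rho> = (\<lambda>g. end_of M (\<phi> g))"
  obtain n where n: "group G" "finite (carrier G)" "order G = p ^ n"
    using G by (auto simp: finite_p_group_def)
  interpret G: group G by fact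
  interpret A: faithful_action G "carrier V" \<phi>
    using act by (simp add: acts_faithfully_def)
  have V': "comm_group V" "finite (carrier V)" "\<And>v. v \<in> carrier V \<Longrightarrow> v [^]\<^bsub>V\<^esub> p = \<one>\<^bsub>V\<^esub>"
    using V by (auto simp: elementary_abelian_def)
  interpret V: comm_group V by (rule V'(1))
  have M: "comm_group M" unfolding M_def by (rule comm_group_base_monoid[OF V'(1)])
  have Mc: "carrier M = carrier V" by (simp add: M_def)
  have hom: "\<phi> g \<in> hom M M" if "g \<in> carrier G" for g
    using act that by (auto simp: acts_faithfully_def auto_def hom_def M_def)
  have cl: "\<phi> g v \<in> carrier V" if "g \<in> carrier G" "v \<in> carrier V" for g v
    using A.element_image that by blast
  have one: "\<phi> \<one>\<^bsub>G\<^esub> v = v" if "v \<in> carrier V" for v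
    using A.id_eq_one that by (metis restrict_apply')
  have diff: "app (\<rho> g - 1) (k, f) = (0, summand M (\<phi> g (component M f) \<otimes>\<^bsub>V\<^esub> inv\<^bsub>V\<^esub> (component M f)))"
    if "g \<in> carrier G" for g k f
    using app_end_of_diff[OF M hom[OF that]] by (simp add: \<rho>_def M_def)
  have compc: "component M f \<in> carrier V" for f using component_closed[OF M] Mc by auto
  have "p_group_of_units G \<rho> p n (vec M ` carrier V)"
  proof (unfold_locales)
    fix g h assume gh: "g \<in> carrier G" "h \<in> carrier G"
    show "\<rho> (g \<otimes>\<^bsub>G\<^esub> h) = \<rho> g * \<rho> h"
    proof (rule app_ext)
      fix x :: "int \<times> 'v ab_product"
      have "on_summand M (\<phi> (g \<otimes>\<^bsub>G\<^esub> h)) (snd x) = on_summand M (\<phi> g) (on_summand M (\<phi> h) (snd x))"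
        by (rule on_summand_comp[OF M]) (use gh hom A.composition_rule Mc in auto)
      then show "app (\<rho> (g \<otimes>\<^bsub>G\<^esub> h)) x = app (\<rho> g * \<rho> h) x"
        by (cases x) (simp add: \<rho>_def app_simps app_end_of)
    qed
  next
    show "\<rho> \<one>\<^bsub>G\<^esub> = 1"
      by (rule app_ext) (use on_summand_id[OF M hom[OF G.one_closed]] one Mc in \<open>auto simp: \<rho>_def app_simps app_end_of\<close>)
  next
    show "inj_on \<rho> (carrier G)"
    proof (rule inj_onI)
      fix g h assume gh: "g \<in> carrier G" "h \<in> carrier G" and eq: "\<rho> g = \<rho> h"
      have "\<phi> g v = \<phi> h v" if v: "v \<in> carrier V" for v
      proof -
        have "vec M (\<phi> g v) = vec M (\<phi> h v)"
          using eq end_of_vec[OF M hom[OF gh(1)]] end_of_vec[OF M hom[OF gh(2)]] v Mc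
          unfolding \<rho>_def by metis
        then show ?thesis using inj_onD[OF inj_vec[OF M]] cl gh v Mc by metis
      qed
      moreover have "\<phi> g \<in> extensional (carrier V)" "\<phi> h \<in> extensional (carrier V)"
        using A.bij_prop0 gh by (auto simp: Bij_def)
      ultimately have "\<phi> g = \<phi> h" by (rule extensionalityI[rotated 2])
      then show "g = h" using A.faithful gh by (simp add: inj_onD)
    qed
  next
    fix g assume g: "g \<in> carrier G"
    show "of_nat p * (\<rho> g - 1) = 0"
    proof (rule app_ext)
      fix x :: "int \<times> 'v ab_product"
      obtain k f where x: "x = (k, f)" by (cases x)
      let ?u = "\<phi> g (component M f) \<otimes>\<^bsub>V\<^esub> inv\<^bsub>V\<^esub> (component M f)"
      have u: "?u \<in> carrier V" using cl g compc by simp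
      have "app (of_nat p * (\<rho> g - 1)) x = (0, summand M (?u [^]\<^bsub>M\<^esub> p))"
        by (rule app_of_nat_mult_summand[OF M]) (use u Mc diff[OF g] x in auto)
      also have "?u [^]\<^bsub>M\<^esub> p = \<one>\<^bsub>M\<^esub>" using V'(3)[OF u] by (simp add: M_def)
      finally show "app (of_nat p * (\<rho> g - 1)) x = app 0 x"
        using summand_one[OF M] by (simp add: app_simps zero_prod_def)
    qed
  next
    show "add_subgroup (vec M ` carrier V)"
      unfolding add_subgroup_def
    proof (intro conjI ballI)
      show d: "x - y \<in> vec M ` carrier V" if "x \<in> vec M ` carrier V" "y \<in> vec M ` carrier V" for x y
        using that vec_diff[OF M] Mc by (auto simp: M_def)
      show "0 \<in> vec M ` carrier V"
        using d[of "vec M \<one>\<^bsub>V\<^esub>" "vec M \<one>\<^bsub>V\<^esub>"] by simp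
    qed
  next
    fix g w assume "g \<in> carrier G" "w \<in> vec M ` carrier V"
    then show "\<rho> g * w \<in> vec M ` carrier V"
      using end_of_vec[OF M hom] cl Mc by (auto simp: \<rho>_def)
  next
    fix g h assume gh: "g \<in> carrier G" "h \<in> carrier G"
      and zero: "\<And>w. w \<in> vec M ` carrier V \<Longrightarrow> (\<rho> g - 1) * ((\<rho> h - 1) * w) = 0"
    show "(\<rho> g - 1) * (\<rho> h - 1) = 0"
    proof (rule app_ext)
      fix x :: "int \<times> 'v ab_product"
      obtain k f where x: "x = (k, f)" by (cases x)
      let ?v = "component M f"
      have v: "?v \<in> carrier V" by (rule compc)
      have "app (vec M ?v) (1, 0) = (0, summand M ?v)"
        using app_vec[OF M, of ?v 1 0] v Mc group.int_pow_1[OF comm_group_facts(1)[OF M]] by simp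
      then have "app (\<rho> h - 1) x = app ((\<rho> h - 1) * vec M ?v) (1, 0)"
        unfolding x using diff[OF gh(2)] component_summand[OF M] v Mc by (simp add: app_simps(5))
      then have "app ((\<rho> g - 1) * (\<rho> h - 1)) x = app ((\<rho> g - 1) * ((\<rho> h - 1) * vec M ?v)) (1, 0)"
        by (simp add: app_simps(5))
      then show "app ((\<rho> g - 1) * (\<rho> h - 1)) x = app 0 x"
        using zero[of "vec M ?v"] v by (simp add: app_simps(1))
    qed
  qed (use n p V'(2) in auto)
  then show ?thesis using that unfolding \<rho>_def M_def by blast
qed

text \<open>In the semidirect product, \<open>[v, e] = v * (e (v\<^sup>-\<^sup>1))\<close>. If all these elements are fixed by \<open>E\<close>, so are
  the elements of the subgroup they generate, and these commute with \<open>E\<close>.\<close>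

lemma acts_quadraticallyI:
  assumes V: "comm_group V" and act: "acts_faithfully G V \<phi>" and E: "subgroup E G" "E \<noteq> {\<one>\<^bsub>G\<^esub>}"
    and quad: "\<And>e f v. e \<in> E \<Longrightarrow> f \<in> E \<Longrightarrow> v \<in> carrier V \<Longrightarrow>
      \<phi> f (v \<otimes>\<^bsub>V\<^esub> \<phi> e (inv\<^bsub>V\<^esub> v)) = v \<otimes>\<^bsub>V\<^esub> \<phi> e (inv\<^bsub>V\<^esub> v)"
  shows "acts_quadratically G V \<phi> E"
proof -
  interpret V: comm_group V by fact
  interpret A: faithful_action G "carrier V" \<phi>
    using act by (simp add: acts_faithfully_def)
  interpret G: group G using A.group_hom by (simp add: group_hom_def)
  interpret E: subgroup E G by fact
  define S where "S = semidirect V G \<phi>"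
  interpret S: group S unfolding S_def by (rule semidirect_group[OF V.is_group act])
  have cl: "\<phi> g v \<in> carrier V" if "g \<in> carrier G" "v \<in> carrier V" for g v
    using A.element_image that by blast
  have one: "\<phi> \<one>\<^bsub>G\<^esub> v = v" if "v \<in> carrier V" for v
    using A.id_eq_one that by (metis restrict_apply')
  have hom: "\<phi> g \<in> hom V V" if "g \<in> carrier G" for g
    using act that by (auto simp: acts_faithfully_def auto_def)
  have gh: "group_hom V V (\<phi> g)" if "g \<in> carrier G" for g
    using hom[OF that] by unfold_locales
  have Sc: "carrier S = carrier V \<times> carrier G" by (simp add: S_def semidirect_def)
  have Sm: "(v, g) \<otimes>\<^bsub>S\<^esub> (w, h) = (v \<otimes>\<^bsub>V\<^esub> \<phi> g w, g \<otimes>\<^bsub>G\<^esub> h)" for v g w h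
    by (simp add: S_def semidirect_def)
  have S1: "\<one>\<^bsub>S\<^esub> = (\<one>\<^bsub>V\<^esub>, \<one>\<^bsub>G\<^esub>)" by (simp add: S_def semidirect_def)
  have iv: "inv\<^bsub>S\<^esub> (v, \<one>\<^bsub>G\<^esub>) = (inv\<^bsub>V\<^esub> v, \<one>\<^bsub>G\<^esub>)" if "v \<in> carrier V" for v
    by (rule S.inv_equality) (use that one in \<open>auto simp: Sm Sc S1\<close>)
  have ig: "inv\<^bsub>S\<^esub> (\<one>\<^bsub>V\<^esub>, g) = (\<one>\<^bsub>V\<^esub>, inv\<^bsub>G\<^esub> g)" if "g \<in> carrier G" for g
    by (rule S.inv_equality) (use that group_hom.hom_one[OF gh] in \<open>auto simp: Sm Sc S1\<close>)
  have comm: "(v, \<one>\<^bsub>G\<^esub>) \<otimes>\<^bsub>S\<^esub> (\<one>\<^bsub>V\<^esub>, e) \<otimes>\<^bsub>S\<^esub> inv\<^bsub>S\<^esub> (v, \<one>\<^bsub>G\<^esub>) \<otimes>\<^bsub>S\<^esub> inv\<^bsub>S\<^esub> (\<one>\<^bsub>V\<^esub>, e)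
      = (v \<otimes>\<^bsub>V\<^esub> \<phi> e (inv\<^bsub>V\<^esub> v), \<one>\<^bsub>G\<^esub>)" if "v \<in> carrier V" "e \<in> carrier G" for v e
    using that one cl group_hom.hom_one[OF gh] by (simp add: Sm iv ig)
  define U where "U = {(u, \<one>\<^bsub>G\<^esub>) | u. u \<in> carrier V \<and> (\<forall>f\<in>E. \<phi> f u = u)}"
  have U: "subgroup U S"
  proof (rule S.subgroupI)
    show "U \<subseteq> carrier S" by (auto simp: U_def Sc)
    have "(\<one>\<^bsub>V\<^esub>, \<one>\<^bsub>G\<^esub>) \<in> U" using group_hom.hom_one[OF gh] by (auto simp: U_def)
    then show "U \<noteq> {}" by blast
    show "inv\<^bsub>S\<^esub> a \<in> U" if "a \<in> U" for a
      using that group_hom.hom_inv[OF gh] by (auto simp: U_def iv)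
    show "a \<otimes>\<^bsub>S\<^esub> b \<in> U" if "a \<in> U" "b \<in> U" for a b
      using that one group_hom.hom_mult[OF gh] by (auto simp: U_def Sm)
  qed
  have 1: "commutator_subgroup S (carrier V \<times> {\<one>\<^bsub>G\<^esub>}) ({\<one>\<^bsub>V\<^esub>} \<times> E) \<subseteq> U"
    unfolding commutator_subgroup_def
  proof (rule S.generate_subgroup_incl[OF _ U], rule subsetI)
    fix x assume "x \<in> {a \<otimes>\<^bsub>S\<^esub> b \<otimes>\<^bsub>S\<^esub> inv\<^bsub>S\<^esub> a \<otimes>\<^bsub>S\<^esub> inv\<^bsub>S\<^esub> b |a b. a \<in> carrier V \<times> {\<one>\<^bsub>G\<^esub>} \<and> b \<in> {\<one>\<^bsub>V\<^esub>} \<times> E}"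
    then obtain v e where ve: "v \<in> carrier V" "e \<in> E"
      "x = (v, \<one>\<^bsub>G\<^esub>) \<otimes>\<^bsub>S\<^esub> (\<one>\<^bsub>V\<^esub>, e) \<otimes>\<^bsub>S\<^esub> inv\<^bsub>S\<^esub> (v, \<one>\<^bsub>G\<^esub>) \<otimes>\<^bsub>S\<^esub> inv\<^bsub>S\<^esub> (\<one>\<^bsub>V\<^esub>, e)"
      by auto
    then show "x \<in> U" using comm[of v e] quad cl by (auto simp: U_def)
  qed
  let ?D = "commutator_subgroup S (carrier V \<times> {\<one>\<^bsub>G\<^esub>}) ({\<one>\<^bsub>V\<^esub>} \<times> E)"
  have "commutator_subgroup S ?D ({\<one>\<^bsub>V\<^esub>} \<times> E) \<subseteq> {\<one>\<^bsub>S\<^esub>}"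
    unfolding commutator_subgroup_def[of S ?D]
  proof (rule S.generate_subgroup_incl[OF _ S.triv_subgroup], rule subsetI)
    fix x assume "x \<in> {a \<otimes>\<^bsub>S\<^esub> b \<otimes>\<^bsub>S\<^esub> inv\<^bsub>S\<^esub> a \<otimes>\<^bsub>S\<^esub> inv\<^bsub>S\<^esub> b |a b. a \<in> ?D \<and> b \<in> {\<one>\<^bsub>V\<^esub>} \<times> E}"
    then obtain a e where a: "a \<in> ?D" "e \<in> E"
      "x = a \<otimes>\<^bsub>S\<^esub> (\<one>\<^bsub>V\<^esub>, e) \<otimes>\<^bsub>S\<^esub> inv\<^bsub>S\<^esub> a \<otimes>\<^bsub>S\<^esub> inv\<^bsub>S\<^esub> (\<one>\<^bsub>V\<^esub>, e)" by auto
    then have "a \<in> U" using 1 by blast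
    then obtain u where u: "a = (u, \<one>\<^bsub>G\<^esub>)" "u \<in> carrier V" "\<And>f. f \<in> E \<Longrightarrow> \<phi> f u = u"
      by (auto simp: U_def)
    have "\<phi> e (inv\<^bsub>V\<^esub> u) = inv\<^bsub>V\<^esub> u" using group_hom.hom_inv[OF gh] u a(2) by auto
    then show "x \<in> {\<one>\<^bsub>S\<^esub>}" using comm[of u e] a u by (simp add: S1)
  qed
  moreover have "\<one>\<^bsub>S\<^esub> \<in> commutator_subgroup S ?D ({\<one>\<^bsub>V\<^esub>} \<times> E)"
    unfolding commutator_subgroup_def[of S ?D] by (rule generate.one)
  ultimately have "commutator_subgroup S ?D ({\<one>\<^bsub>V\<^esub>} \<times> E) = {\<one>\<^bsub>S\<^esub>}" by blast
  moreover have "centralizer_in V \<phi> E \<noteq> carrier V"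
  proof
    assume c: "centralizer_in V \<phi> E = carrier V"
    have "e = \<one>\<^bsub>G\<^esub>" if e: "e \<in> E" for e
    proof -
      have "\<phi> e v = \<phi> \<one>\<^bsub>G\<^esub> v" if "v \<in> carrier V" for v
        using that c e one by (auto simp: centralizer_in_def)
      moreover have "\<phi> e \<in> extensional (carrier V)" "\<phi> \<one>\<^bsub>G\<^esub> \<in> extensional (carrier V)"
        using A.bij_prop0 e by (auto simp: Bij_def)
      ultimately have "\<phi> e = \<phi> \<one>\<^bsub>G\<^esub>" by (rule extensionalityI[rotated 2])
      then show ?thesis using A.faithful e by (simp add: inj_onD)
    qed
    then show False using E(2) E.one_closed by blast
  qed
  ultimately show ?thesis by (simp add: acts_quadratically_def Let_def S_def)
qed

section \<open>Offenders that are normal in their normal closure\<close>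

theorem theorem3:
  fixes p :: nat
    and G :: "('g, 'm) monoid_scheme"
    and V :: "('v, 'n) monoid_scheme"
    and \<phi> :: "'g \<Rightarrow> 'v \<Rightarrow> 'v"
  assumes "prime p" and "p \<ge> 5"
    and "finite_p_group p G"
    and "elementary_abelian p V"
    and "F_module p G V \<phi>"
  shows "\<exists>E. quadratic_offender p G V \<phi> E \<and> E \<lhd> (G\<lparr>carrier := normal_closure G E\<rparr>)"
proof -
  have act: "acts_faithfully G V \<phi>" using assms(5) by (simp add: F_module_def)
  obtain A where A: "offender p G V \<phi> A" using assms(5) by (auto simp: F_module_def)
  have V: "comm_group V" using assms(4) by (simp add: elementary_abelian_def)
  define M where "M = base_monoid V"
  obtain n where "p_group_of_units G (\<lambda>g. end_of M (\<phi> g)) p n (vec M ` carrier V)"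
    using p_group_of_units_of_action[OF assms(1-4) act] unfolding M_def .
  then interpret U: p_group_of_units G "\<lambda>g. end_of M (\<phi> g)" p n "vec M ` carrier V" .
  interpret V: comm_group V by (rule V)
  interpret act: faithful_action G "carrier V" \<phi>
    using act by (simp add: acts_faithfully_def)
  have M: "comm_group M" unfolding M_def by (rule comm_group_base_monoid[OF V])
  have Mc: "carrier M = carrier V" by (simp add: M_def)
  have hom: "\<phi> g \<in> hom M M" if "g \<in> carrier G" for g
    using act that by (auto simp: acts_faithfully_def auto_def hom_def M_def)
  have cl: "\<phi> g v \<in> carrier V" if "g \<in> carrier G" "v \<in> carrier V" for g v
    using act.element_image that by blast
  have inj: "inj_on (vec M) (carrier V)" using inj_vec[OF M] Mc by simp
  have vec_act: "end_of M (\<phi> g) * vec M v = vec M (\<phi> g v)" if "g \<in> carrier G" "v \<in> carrier V" for g v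
    using end_of_vec[OF M hom] that Mc by simp
  have fixed: "U.fixed F = vec M ` centralizer_in V \<phi> F" if F: "F \<subseteq> carrier G" for F
  proof -
    have "end_of M (\<phi> e) * vec M v = vec M v \<longleftrightarrow> \<phi> e v = v" if "e \<in> F" "v \<in> carrier V" for e v
      using vec_act[of e v] cl[of e v] F that inj_on_eq_iff[OF inj] by auto
    then show ?thesis by (auto simp: U.fixed_def centralizer_in_def)
  qed
  have card_fixed: "card (U.fixed F) = card (centralizer_in V \<phi> F)" if "F \<subseteq> carrier G" for F
    unfolding fixed[OF that]
    by (rule card_image[OF inj_on_subset[OF inj]]) (auto simp: centralizer_in_def)
  have cardW: "card (vec M ` carrier V) = card (carrier V)" by (rule card_image[OF inj])
  interpret A: subgroup A G using A by (simp add: offender_def)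
  have "\<exists>E. U.quad E"
  proof (rule U.quad_replacement)
    show "subgroup A G" by (rule A.subgroup_axioms)
    show "A \<noteq> {\<one>\<^bsub>G\<^esub>}" using A by (simp add: offender_def)
    have ea: "elementary_abelian p (G\<lparr>carrier := A\<rparr>)" using A by (simp add: offender_def)
    then interpret cA: comm_group "G\<lparr>carrier := A\<rparr>" by (simp add: elementary_abelian_def)
    show "a \<otimes>\<^bsub>G\<^esub> b = b \<otimes>\<^bsub>G\<^esub> a" if "a \<in> A" "b \<in> A" for a b using cA.m_comm that by simp
    show "a [^]\<^bsub>G\<^esub> p = \<one>\<^bsub>G\<^esub>" if "a \<in> A" for a
      using ea that by (simp add: elementary_abelian_def flip: U.nat_pow_consistent)
    show "card (vec M ` carrier V) \<le> card A * card (U.fixed A)"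
      using A by (simp add: offender_def card_fixed[OF A.subset] cardW)
  qed
  then obtain E where E: "U.quad E"
    and norm: "{g \<in> carrier G. (end_of M (\<phi> g) - 1) * (end_of M (\<phi> g) - 1) = 0} \<subseteq> normalizing G E"
    using U.quad_normalized_by_quadratic_elements by blast
  have Esub: "subgroup E G" and E1: "E \<noteq> {\<one>\<^bsub>G\<^esub>}"
    and sq: "\<And>e f. e \<in> E \<Longrightarrow> f \<in> E \<Longrightarrow> (end_of M (\<phi> e) - 1) * (end_of M (\<phi> f) - 1) = 0"
    and large: "card (vec M ` carrier V) \<le> card E * card (U.fixed E)"
    using E by (auto simp: U.quad_def)
  interpret E: subgroup E G by (rule Esub)
  have finE: "finite E" by (rule finite_subset[OF E.subset U.fin])
  have "comm_group (G\<lparr>carrier := E\<rparr>)"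
  proof (rule group.group_comm_groupI[OF U.subgroup_imp_group[OF Esub]])
    fix e f assume "e \<in> carrier (G\<lparr>carrier := E\<rparr>)" "f \<in> carrier (G\<lparr>carrier := E\<rparr>)"
    then have ef: "e \<in> E" "f \<in> E" by auto
    have expand: "a * b = (a - 1) * (b - 1) + (a + b - 1)" for a b :: "'v ab_end"
      by (simp add: ring_distribs)
    have "end_of M (\<phi> e) * end_of M (\<phi> f) = end_of M (\<phi> f) * end_of M (\<phi> e)"
      using expand[of "end_of M (\<phi> e)" "end_of M (\<phi> f)"] expand[of "end_of M (\<phi> f)" "end_of M (\<phi> e)"]
      unfolding sq[OF ef] sq[OF ef(2,1)] by (simp only: add.commute)
    then have "e \<otimes>\<^bsub>G\<^esub> f = f \<otimes>\<^bsub>G\<^esub> e"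
      using U.rho_inj ef by (intro inj_onD[OF U.rho_inj]) (auto simp: U.rho_mult)
    then show "e \<otimes>\<^bsub>G\<lparr>carrier := E\<rparr>\<^esub> f = f \<otimes>\<^bsub>G\<lparr>carrier := E\<rparr>\<^esub> e" by simp
  qed
  moreover have "e [^]\<^bsub>G\<^esub> p = \<one>\<^bsub>G\<^esub>" if e: "e \<in> E" for e
  proof (rule inj_onD[OF U.rho_inj])
    show "end_of M (\<phi> (e [^]\<^bsub>G\<^esub> p)) = end_of M (\<phi> \<one>\<^bsub>G\<^esub>)"
      using U.rho_power(1)[OF E.mem_carrier[OF e] sq[OF e e], of p] U.rho_torsion[OF E.mem_carrier[OF e]]
      by (simp add: U.rho_one)
  qed (use e in auto)
  ultimately have "elementary_abelian p (G\<lparr>carrier := E\<rparr>)"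
    using finE by (simp add: elementary_abelian_def flip: U.nat_pow_consistent)
  then have off: "offender p G V \<phi> E"
    using Esub E1 large by (simp add: offender_def card_fixed[OF E.subset] cardW)
  have "acts_quadratically G V \<phi> E"
  proof (rule acts_quadraticallyI[OF V act Esub E1])
    fix e f v assume efv: "e \<in> E" "f \<in> E" "v \<in> carrier V"
    let ?x = "v \<otimes>\<^bsub>V\<^esub> \<phi> e (inv\<^bsub>V\<^esub> v)"
    have x: "?x \<in> carrier V" using cl efv by simp
    have "(end_of M (\<phi> e) - 1) * vec M (inv\<^bsub>V\<^esub> v) = vec M (\<phi> e (inv\<^bsub>V\<^esub> v)) - vec M (inv\<^bsub>V\<^esub> v)"
      using vec_act efv by (simp add: left_diff_distrib)
    also have "\<dots> = vec M (\<phi> e (inv\<^bsub>V\<^esub> v) \<otimes>\<^bsub>M\<^esub> inv\<^bsub>M\<^esub> (inv\<^bsub>V\<^esub> v))"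
      by (rule vec_diff[OF M]) (use Mc cl efv in auto)
    also have "\<phi> e (inv\<^bsub>V\<^esub> v) \<otimes>\<^bsub>M\<^esub> inv\<^bsub>M\<^esub> (inv\<^bsub>V\<^esub> v) = ?x"
      using efv cl by (simp add: M_def V.m_comm)
    finally have "(end_of M (\<phi> f) - 1) * vec M ?x = 0"
      using sq[OF efv(2,1)] by (metis mult.assoc mult_zero_left)
    then have "vec M (\<phi> f ?x) = vec M ?x" using vec_act x efv by (simp add: left_diff_distrib)
    then show "\<phi> f ?x = ?x" using inj_onD[OF inj] cl x efv by auto
  qed
  then have "quadratic_offender p G V \<phi> E" using off by (simp add: quadratic_offender_def)
  moreover have "E \<lhd> (G\<lparr>carrier := normal_closure G E\<rparr>)"
  proof -
    let ?X = "{inv\<^bsub>G\<^esub> g \<otimes>\<^bsub>G\<^esub> x \<otimes>\<^bsub>G\<^esub> g | g x. g \<in> carrier G \<and> x \<in> E}"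
    let ?N = "normal_closure G E"
    have X: "?X \<subseteq> carrier G" by auto
    have N: "subgroup ?N G" unfolding normal_closure_def by (rule U.generate_is_subgroup[OF X])
    have "?X \<subseteq> normalizing G E"
    proof
      fix y assume "y \<in> ?X"
      then obtain g x where gx: "g \<in> carrier G" "x \<in> E" "y = inv\<^bsub>G\<^esub> g \<otimes>\<^bsub>G\<^esub> x \<otimes>\<^bsub>G\<^esub> g" by auto
      have y: "end_of M (\<phi> y) - 1 = end_of M (\<phi> (inv\<^bsub>G\<^esub> g)) * (end_of M (\<phi> x) - 1) * end_of M (\<phi> g)"
        using U.conj_shift[of "inv\<^bsub>G\<^esub> g" x] gx by simp
      have "(end_of M (\<phi> y) - 1) * (end_of M (\<phi> y) - 1) = end_of M (\<phi> (inv\<^bsub>G\<^esub> g)) *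
        ((end_of M (\<phi> x) - 1) * (end_of M (\<phi> g) * end_of M (\<phi> (inv\<^bsub>G\<^esub> g))) * (end_of M (\<phi> x) - 1)) * end_of M (\<phi> g)"
        unfolding y by (simp only: mult.assoc)
      also have "\<dots> = 0" using gx sq by (simp add: U.rho_inv)
      finally show "y \<in> normalizing G E" using norm gx by auto
    qed
    then have N_norm: "?N \<subseteq> normalizing G E"
      unfolding normal_closure_def
      by (rule U.generate_subgroup_incl[OF _ U.subgroup_normalizing[OF finE E.subset]])
    have "E \<subseteq> ?X"
    proof
      fix x assume "x \<in> E"
      then show "x \<in> ?X" by (intro CollectI exI[of _ "\<one>\<^bsub>G\<^esub>"] exI[of _ x]) simp
    qed
    then have EN: "E \<subseteq> ?N" unfolding normal_closure_def by (auto intro: generate.incl)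
    show ?thesis
    proof (rule group.normal_invI[OF U.subgroup_imp_group[OF N]])
      show "subgroup E (G\<lparr>carrier := ?N\<rparr>)" by (rule U.subgroup_incl[OF Esub N EN])
      fix x h assume "x \<in> carrier (G\<lparr>carrier := ?N\<rparr>)" "h \<in> E"
      then show "x \<otimes>\<^bsub>G\<lparr>carrier := ?N\<rparr>\<^esub> h \<otimes>\<^bsub>G\<lparr>carrier := ?N\<rparr>\<^esub> inv\<^bsub>G\<lparr>carrier := ?N\<rparr>\<^esub> x \<in> E"
        using N_norm U.m_inv_consistent[OF N] by (auto simp: normalizing_def)
    qed
  qed
  ultimately show ?thesis by blast
qed

end
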